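(* Let $$\mathcal R_{\mathrm{LFs}}=\mathbb E\left[\mathbf 1_{\{\theta_{\mathrm{LU}}\le\theta_{\max}\}}\left(\sum_{i=1}^{N_{\mathrm F}}\min\left\{B_{\mathrm{LF}}\log_2(1+\mathrm{SNR}_{\mathrm{LF},i}),\,B_{\mathrm{FU}}\log_2(1+\mathrm{SNR}_{\mathrm{FU},i})\right\}+B_{\mathrm{LU}}\log_2(1+\mathrm{SNR}_{\mathrm{LU}})\right)\right]$$ be the average data rate of the satellite cluster. Then $$\mathcal R_{\mathrm{LFs}}=N_{\mathrm F}\int_0^\infty E(w)f_{W_{\mathrm U}}(w)\,\mathrm dw+\mathcal R_{\mathrm{LU}},$$ where $$\mathcal R_{\mathrm{LU}}=\int_0^{\theta_{\max}}\int_0^\infty B_{\mathrm{LU}}f_{W_{\mathrm U}}(w)f_{\theta_{\mathrm{LU}}}(\theta)\log_2\left(1+\frac{\xi_{\mathrm{LU}}w}{r_{\mathrm{LU}}^2(\theta)}\right)\mathrm dw\,\mathrm d\theta,$$ $$E(w)=\int_0^{2\pi}\int_0^{\theta_{\mathrm{cap}}}\int_0^{\theta_{\max}}\frac{\sin\psi\,f_{\theta_{\mathrm{LU}}}(\theta)}{2\pi(1-\cos\theta_{\mathrm{cap}})}\min\left\{\mathcal R_{\mathrm{LF},i}(\psi),\mathcal R_{\mathrm{FU},i}(w,\theta,\psi,\varphi)\right\}\mathrm d\theta\,\mathrm d\psi\,\mathrm d\varphi,$$ $$\mathcal R_{\mathrm{LF},i}(\psi)=B_{\mathrm{LF}}\log_2\left(1+\xi_{\mathrm{LF}}\frac{W_{\mathrm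 F}}{r_{\mathrm{LF}}^2(\psi)}\right),\qquad \mathcal R_{\mathrm{FU},i}(w,\theta,\psi,\varphi)=B_{\mathrm{FU}}\log_2\left(1+\xi_{\mathrm{FU}}\frac{w}{r_{\mathrm{FU}}^2(\theta,\psi,\varphi)}\right),$$ with $$f_{\theta_{\mathrm{LU}}}(\theta)=\frac{N_{\mathrm L}\sin\theta}{2}\left(\frac{1+\cos\theta}{2}\right)^{N_{\mathrm L}-1},\quad r_{\mathrm{LU}}(\theta)=\sqrt{R_{\mathrm{sat}}^2+R_\oplus^2-2R_{\mathrm{sat}}R_\oplus\cos\theta},\quad r_{\mathrm{LF}}(\psi)=R_{\mathrm{sat}}\sqrt{2(1-\cos\psi)},$$ $$r_{\mathrm{FU}}(\theta,\psi,\varphi)=\left(R_\oplus^2+R_{\mathrm{sat}}^2-2R_\oplus R_{\mathrm{sat}}(\sin\theta\sin\psi\cos\varphi+\cos\theta\cos\psi)\right)^{1/2}.$$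
   Context: Geometry: $R_\oplus>0$ is the Earth radius, $h_{\mathrm{sat}}>0$, $R_{\mathrm{sat}}=R_\oplus+h_{\mathrm{sat}}$. The user is a fixed point on the sphere of radius $R_\oplus$ centred at the Earth's centre $O$. $N_{\mathrm L}\ge1$ leader satellites are i.i.d. uniformly distributed on the sphere of radius $R_{\mathrm{sat}}$ centred at $O$ (homogeneous binomial point process). The central angle between two devices is the angle at $O$ between the segments joining $O$ to them. The associated leader is the leader nearest to the user, and $\theta_{\mathrm{LU}}$ is the central angle between it and the user. Its $N_{\mathrm F}\ge1$ followers are, given the leader positions, i.i.d. uniformly distributed (homogeneous binomial point process) on the spherical cap of the sphere of radius $R_{\mathrm{sat}}$ consisting of all points whose central angle to the associated leader is at most $\theta_{\mathrm{cap}}>0$. $\theta_{\max}$ is the maximum central angle at which a leader can serve the user, $0<\theta_{\max}\le\arccos(R_\oplus/R_{\mathrm{sat}})-\theta_{\mathrm{cap}}$. Channel: $\mathrm{SNR}_{\mathrm{LU}}=\xi_{\mathrm{LU}}W_{\mathrm{U},0}/r_{\mathrm{LU}}^2$, $\mathrm{SNR}_{\mathrm{FU},i}=\xi_{\mathrm{FU}}W_{\mathrm{U},i}/r_{\mathrm{FU},i}^2$, $\mathrm{SNR}_{\mathrm{LF},i}=\xi_{\mathrm{LF}}W_{\mathrm F}/r_{\mathrm{LF},i}^2$, where $r_{\mathrm{LU}}$, $r_{\mathrm{FU},i}$, $r_{\mathrm{LF},i}$ are the Euclidean distances leader-user, $i$-th follower-user, leader-$i$-th follower, and $\xi_{Q_1Q_2}=\rho_{Q_1Q_2}G_{Q_1Q_2}\zeta_{Q_2}\left(\frac{\nu_{Q_1Q_2}}{4\pi\sigma_{Q_2}}\right)^2>0$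 for $Q_1Q_2\in\{\mathrm{LU},\mathrm{FU},\mathrm{LF}\}$ are constants (transmit power, antenna gain, rain attenuation with $\zeta_{\mathrm F}=1$, wavelength, noise standard deviation, all positive). $B_{\mathrm{LU}},B_{\mathrm{FU}},B_{\mathrm{LF}}>0$ are bandwidths. Small-scale fading on the inter-satellite link is neglected: $W_{\mathrm F}$ is a deterministic constant, $W_{\mathrm F}=1$. The fading powers $W_{\mathrm U,0},\dots,W_{\mathrm U,N_{\mathrm F}}\ge0$ are independent of each other and of all positions, each with density $f_{W_{\mathrm U}}$ and shadowed-Rician CDF (parameters $\Omega,b_0,m>0$) $$F_{W_{\mathrm U}}(w)=\left(\frac{2b_0m}{2b_0m+\Omega}\right)^m\sum_{z=0}^\infty\frac{(m)_z}{z!\,\Gamma(z+1)}\left(\frac{\Omega}{2b_0m+\Omega}\right)^z\int_0^{w/(2b_0)}t^ze^{-t}\,\mathrm dt,\quad w\ge0,$$ with $(m)_z$ the Pochhammer symbol. *)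

theory Defs
  imports "HOL-Probability.Probability"
begin

section \<open>Geometry\<close>

text \<open>The angle at the origin between the segments to \<open>x\<close> and to \<open>y\<close>.\<close>

definition central_angle :: "real^3 \<Rightarrow> real^3 \<Rightarrow> real" where
  "central_angle x y = arccos (inner x y / (norm x * norm y))"

text \<open>
  There is no surface measure on spheres in the library. The normalised surface measure on the
  sphere of radius \<open>R\<close> is obtained by radially projecting the uniform distribution on the unit
  ball; it gives a Borel set \<open>A\<close> of the unit sphere the volume of the cone over \<open>A\<close> with apex
  \<open>0\<close>, divided by the volume of the ball. The centre of the ball is a null set.
\<close>

definition uniform_sphere :: "real \<Rightarrow> (real^3) measure" where
  "uniform_sphere R =
     distr (uniform_measure lborel (ball 0 1)) borel (\<lambda>x. (R / norm x) *\<^sub>R x)"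

definition spherical_cap :: "real \<Rightarrow> real \<Rightarrow> real^3 \<Rightarrow> (real^3) set" where
  "spherical_cap R \<theta>cap c = {x. norm x = R \<and> central_angle c x \<le> \<theta>cap}"

definition uniform_cap :: "real \<Rightarrow> real \<Rightarrow> real^3 \<Rightarrow> (real^3) measure" where
  "uniform_cap R \<theta>cap c = uniform_measure (uniform_sphere R) (spherical_cap R \<theta>cap c)"

text \<open>
  Index of the point among \<open>x 1, \<dots>, x n\<close> that is nearest to \<open>u\<close>. Ties are resolved in favour
  of the smallest index; for i.i.d. uniform points on a sphere they have probability zero.
\<close>

definition nearest :: "nat \<Rightarrow> (nat \<Rightarrow> real^3) \<Rightarrow> real^3 \<Rightarrow> nat" where
  "nearest n x u = (LEAST j. j \<in> {1..n} \<and> (\<forall>k\<in>{1..n}. dist (x j) u \<le> dist (x k) u))"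

section \<open>Probability\<close>

text \<open>
  Given the sub-sigma-algebra \<open>G\<close>, the variables \<open>X i\<close> (\<open>i \<in> I\<close>, with \<open>I\<close> finite) are
  independent, each with the (\<open>G\<close>-measurable, random) law \<open>\<kappa> \<omega>\<close>.
\<close>

definition cond_iid ::
  "'a measure \<Rightarrow> 'a measure \<Rightarrow> 'i set \<Rightarrow> ('i \<Rightarrow> 'a \<Rightarrow> real^3) \<Rightarrow> ('a \<Rightarrow> (real^3) measure) \<Rightarrow> bool" where
  "cond_iid M G I X \<kappa> \<longleftrightarrow>
     (\<forall>i\<in>I. X i \<in> borel_measurable M) \<and>
     (\<forall>A. (\<forall>i\<in>I. A i \<in> sets borel) \<longrightarrow>
        (AE \<omega> in M. real_cond_exp M G (indicator {\<omega>\<in>space M. \<forall>i\<in>I. X i \<omega> \<in> A i}) \<omega>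
                    = (\<Prod>i\<in>I. measure (\<kappa> \<omega>) (A i))))"

definition shadowed_rician_cdf :: "real \<Rightarrow> real \<Rightarrow> real \<Rightarrow> real \<Rightarrow> real" where
  "shadowed_rician_cdf \<Omega> b0 m w =
     (2 * b0 * m / (2 * b0 * m + \<Omega>)) powr m *
     (\<Sum>z. pochhammer m z / (fact z * Gamma (real z + 1)) * (\<Omega> / (2 * b0 * m + \<Omega>)) ^ z *
          (LBINT t:{0..w / (2 * b0)}. t ^ z * exp (- t)))"

section \<open>Channel\<close>

text \<open>Links leader-user, follower-user, leader-follower, and the receiving device of each.\<close>

datatype link = LU | FU | LF

datatype receiver = User | Follower

primrec rx :: "link \<Rightarrow> receiver" where
  "rx LU = User"
| "rx FU = User"
| "rx LF = Follower"

text \<open>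
  Arguments: transmit power, antenna gain, rain attenuation, noise standard deviation, wavelength.
\<close>

definition link_const ::
  "(link \<Rightarrow> real) \<Rightarrow> (link \<Rightarrow> real) \<Rightarrow> (receiver \<Rightarrow> real) \<Rightarrow> (receiver \<Rightarrow> real) \<Rightarrow> (link \<Rightarrow> real)
    \<Rightarrow> link \<Rightarrow> real" where
  "link_const \<rho> G \<zeta> \<sigma> \<nu> q = \<rho> q * G q * \<zeta> (rx q) * (\<nu> q / (4 * pi * \<sigma> (rx q)))\<^sup>2"

text \<open>Channel gain constant, fading power, distance.\<close>

definition snr :: "real \<Rightarrow> real \<Rightarrow> real \<Rightarrow> real" where
  "snr \<xi> w r = \<xi> * w / r\<^sup>2"

definition shannon :: "real \<Rightarrow> real \<Rightarrow> real" where
  "shannon B s = B * log 2 (1 + s)"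

section \<open>The functions in the closed-form expression\<close>

definition f_LU :: "nat \<Rightarrow> real \<Rightarrow> real" where
  "f_LU NL \<theta> = real NL * sin \<theta> / 2 * ((1 + cos \<theta>) / 2) ^ (NL - 1)"

definition r_LU :: "real \<Rightarrow> real \<Rightarrow> real \<Rightarrow> real" where
  "r_LU Rearth Rsat \<theta> = sqrt (Rsat\<^sup>2 + Rearth\<^sup>2 - 2 * Rsat * Rearth * cos \<theta>)"

definition r_LF :: "real \<Rightarrow> real \<Rightarrow> real" where
  "r_LF Rsat \<psi> = Rsat * sqrt (2 * (1 - cos \<psi>))"

definition r_FU :: "real \<Rightarrow> real \<Rightarrow> real \<Rightarrow> real \<Rightarrow> real \<Rightarrow> real" where
  "r_FU Rearth Rsat \<theta> \<psi> \<phi> =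
     sqrt (Rearth\<^sup>2 + Rsat\<^sup>2 - 2 * Rearth * Rsat * (sin \<theta> * sin \<psi> * cos \<phi> + cos \<theta> * cos \<psi>))"

end

theory Submission
  imports Defs
begin

text \<open>
  The leader nearest to the user is the one with the smallest central angle, and a single angle has
  density \<open>sin \<theta> / 2\<close> on \<open>[0, \<pi>]\<close>; so the angle of the associated leader exceeds \<open>\<theta>\<close>
  with probability \<open>((1 + cos \<theta>) / 2) ^ NL\<close>, which yields the density \<open>f_LU\<close>. Given the leaders,
  a follower has density \<open>2 / (1 - cos \<theta>cap)\<close> on the cap with respect to the uniform law on the
  sphere. By rotation invariance one may put the leader at the north pole and the user in the
  half-plane of azimuth \<open>0\<close>; then the two distances of the follower depend on its spherical
  coordinates through \<open>r_LF\<close> and \<open>r_FU\<close>, and on the leader only through its angle.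

  All interchanges of integrals are Tonelli's theorem. The Bochner integrals of the statement are
  genuine because all rates are dominated by a multiple of a fading power, and the shadowed-Rician
  law has finite mean.
\<close>

section \<open>Spherical coordinates\<close>

text \<open>The sphere law is defined through volumes of cones in the unit ball, so its density in
  the angles has to come from a change of variables in space: the radial integral
  \<open>1 / 3\<close> against the ball volume \<open>4 / 3 * pi\<close> leaves the constant
  \<open>1 / (4 * pi)\<close>. Two obstacles shape the rest. Conditional independence is given event
  by event, each with its own exceptional null set. It is therefore turned into an equality of joint
  laws of leader and follower, checked on rectangles, with the cap written as a density against the
  fixed sphere law. And the closed form consists of nested Bochner integrals, which are 0 by
  convention where a function is not integrable; finiteness of the outermost extended integral
  confines the harmful points to null sets. The domination behind this finiteness has to use the
  follower-user rate: the leader-follower rate is unbounded as the follower approaches the leader,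
  whereas almost surely no satellite comes closer to the user than
  \<open>Rsat - Rearth\<close>.\<close>

definition direction :: "real \<Rightarrow> real \<Rightarrow> real^3" where
  "direction \<psi> \<phi> = vector [sin \<psi> * cos \<phi>, sin \<psi> * sin \<phi>, cos \<psi>]"

lemma direction_nth [simp]:
  "direction \<psi> \<phi> $ 1 = sin \<psi> * cos \<phi>" "direction \<psi> \<phi> $ 2 = sin \<psi> * sin \<phi>"
  "direction \<psi> \<phi> $ 3 = cos \<psi>"
  by (simp_all add: direction_def)

lemma norm_direction [simp]: "norm (direction \<psi> \<phi>) = 1"
proof -
  have "(sin \<psi> * cos \<phi>)\<^sup>2 + (sin \<psi> * sin \<phi>)\<^sup>2 + (cos \<psi>)\<^sup>2
      = (sin \<psi>)\<^sup>2 * ((cos \<phi>)\<^sup>2 + (sin \<phi>)\<^sup>2) + (cos \<psi>)\<^sup>2"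
    by algebra
  also have "\<dots> = 1" by simp
  finally have eq: "(sin \<psi> * cos \<phi>)\<^sup>2 + (sin \<psi> * sin \<phi>)\<^sup>2 + (cos \<psi>)\<^sup>2 = 1" .
  show ?thesis
    by (simp only: norm_vec_def L2_set_def sum_3 direction_nth real_norm_def power2_abs eq real_sqrt_one)
qed

lemma borel_measurable_vec_nth3 [measurable]:
  fixes f g h :: "'a \<Rightarrow> real"
  assumes [measurable]: "f \<in> borel_measurable M" "g \<in> borel_measurable M" "h \<in> borel_measurable M"
  shows "(\<lambda>x. vector [f x, g x, h x] :: real^3) \<in> borel_measurable M"
proof (rule borel_measurable_euclidean_space[THEN iffD2], safe)
  fix i :: "real^3" assume "i \<in> Basis"
  then obtain k where k: "i = axis k 1" by (auto simp: Basis_vec_def)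
  have "(\<lambda>x. (vector [f x, g x, h x] :: real^3) $ k) \<in> borel_measurable M"
    using exhaust_3[of k] by auto
  then show "(\<lambda>x. (vector [f x, g x, h x] :: real^3) \<bullet> i) \<in> borel_measurable M"
    by (simp add: k inner_axis)
qed

lemma borel_measurable_direction [measurable]:
  assumes [measurable]: "f \<in> borel_measurable M" "g \<in> borel_measurable M"
  shows "(\<lambda>x. direction (f x) (g x)) \<in> borel_measurable M"
  unfolding direction_def by measurable

section \<open>Lebesgue measure on \<open>real^3\<close> as an iterated integral\<close>

lemma prod_Basis_3:
  fixes f :: "real^3 \<Rightarrow> 'a::comm_monoid_mult"
  shows "(\<Prod>b\<in>Basis. f b) = f (axis 1 1) * f (axis 2 1) * f (axis 3 1)"
proof -
  have B: "(Basis :: (real^3) set) = {axis 1 (1::real), axis 2 1, axis 3 1}"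
    by (auto simp: Basis_vec_def) (metis exhaust_3)
  show ?thesis
    unfolding B by (simp add: axis_eq_axis mult.assoc)
qed

lemma mem_box_3:
  "(x :: real^3) \<in> box l u \<longleftrightarrow> l$1 < x$1 \<and> x$1 < u$1 \<and> l$2 < x$2 \<and> x$2 < u$2 \<and> l$3 < x$3 \<and> x$3 < u$3"
  by (auto simp: mem_box_cart forall_3)

text \<open>Lebesgue measure is characterised by its values on open boxes, and on a box the product
  measure factors into the three side lengths.\<close>

lemma lborel_real_3:
  "(lborel :: (real^3) measure) =
     distr (lborel \<Otimes>\<^sub>M (lborel \<Otimes>\<^sub>M lborel)) borel (\<lambda>(a, b, c). vector [a, b, c])"
proof (rule lborel_eqI)
  fix l u :: "real^3" assume le: "\<And>b. b \<in> Basis \<Longrightarrow> l \<bullet> b \<le> u \<bullet> b"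
  have le': "l $ i \<le> u $ i" for i
    using le[of "axis i 1"] by (simp add: inner_axis)
  have P: "sigma_finite_measure (lborel \<Otimes>\<^sub>M lborel :: (real \<times> real) measure)"
    by (simp add: lborel_prod sigma_finite_lborel)
  have "emeasure (distr (lborel \<Otimes>\<^sub>M (lborel \<Otimes>\<^sub>M lborel)) borel
            (\<lambda>(a, b, c). vector [a, b, c] :: real^3)) (box l u)
        = emeasure (lborel \<Otimes>\<^sub>M (lborel \<Otimes>\<^sub>M lborel))
            ({l$1<..<u$1} \<times> ({l$2<..<u$2} \<times> {l$3<..<u$3}))"
    by (subst emeasure_distr)
       (auto simp: space_pair_measure mem_box_3 intro!: arg_cong2[where f=emeasure])
  also have "\<dots> = ennreal (u$1 - l$1) * (ennreal (u$2 - l$2) * ennreal (u$3 - l$3))"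
    by (subst sigma_finite_measure.emeasure_pair_measure_Times[OF P])
       (auto simp: le' lborel.emeasure_pair_measure_Times)
  finally show "emeasure (distr (lborel \<Otimes>\<^sub>M (lborel \<Otimes>\<^sub>M lborel)) borel
            (\<lambda>(a, b, c). vector [a, b, c] :: real^3)) (box l u) = (\<Prod>b\<in>Basis. (u - l) \<bullet> b)"
    by (simp add: prod_Basis_3 inner_axis le' ennreal_mult mult.assoc)
qed simp

lemma nn_integral_lborel_real_3:
  fixes f :: "real^3 \<Rightarrow> ennreal"
  assumes [measurable]: "f \<in> borel_measurable borel"
  shows "(\<integral>\<^sup>+x. f x \<partial>lborel) = (\<integral>\<^sup>+a. \<integral>\<^sup>+b. \<integral>\<^sup>+c. f (vector [a, b, c]) \<partial>lborel \<partial>lborel \<partial>lborel)"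
proof -
  have P: "sigma_finite_measure (lborel \<Otimes>\<^sub>M lborel :: (real \<times> real) measure)"
    by (simp add: lborel_prod sigma_finite_lborel)
  have "(\<integral>\<^sup>+x. f x \<partial>lborel) =
        (\<integral>\<^sup>+p. (case p of (a, b, c) \<Rightarrow> f (vector [a, b, c])) \<partial>(lborel \<Otimes>\<^sub>M (lborel \<Otimes>\<^sub>M lborel)))"
    by (subst lborel_real_3, subst nn_integral_distr) (auto simp: case_prod_unfold)
  also have "\<dots> = (\<integral>\<^sup>+a. \<integral>\<^sup>+p. (case p of (b, c) \<Rightarrow> f (vector [a, b, c])) \<partial>(lborel \<Otimes>\<^sub>M lborel) \<partial>lborel)"
    by (subst sigma_finite_measure.nn_integral_fst[OF P, symmetric]) auto
  also have "\<dots> = (\<integral>\<^sup>+a. \<integral>\<^sup>+b. \<integral>\<^sup>+c. f (vector [a, b, c]) \<partial>lborel \<partial>lborel \<partial>lborel)"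
    by (intro nn_integral_cong, subst lborel.nn_integral_fst[symmetric]) auto
  finally show ?thesis .
qed

section \<open>Volume in spherical coordinates\<close>

definition spherical_coordinates :: "real^3 \<Rightarrow> real^3" where
  "spherical_coordinates x = (x$1) *\<^sub>R direction (x$2) (x$3)"

text \<open>The total derivative of \<open>spherical_coordinates\<close> at \<open>x\<close>, as a
  linear map in the increment \<open>v\<close>; the volume factor is the determinant of its
  matrix.\<close>

definition spherical_jacobian :: "real^3 \<Rightarrow> real^3 \<Rightarrow> real^3" where
  "spherical_jacobian x v = vector
     [v$1 * (sin (x$2) * cos (x$3)) + x$1 * (v$2 * cos (x$2) * cos (x$3) - v$3 * sin (x$2) * sin (x$3)),
      v$1 * (sin (x$2) * sin (x$3)) + x$1 * (v$2 * cos (x$2) * sin (x$3) + v$3 * sin (x$2) * cos (x$3)),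
      v$1 * cos (x$2) - x$1 * (v$2 * sin (x$2))]"

lemma vec3_eqI: "x$1 = y$1 \<Longrightarrow> x$2 = y$2 \<Longrightarrow> x$3 = y$3 \<Longrightarrow> (x :: 'a^3) = y"
  by (simp add: vec_eq_iff forall_3)

lemma has_derivative_spherical_coordinates:
  "(spherical_coordinates has_derivative spherical_jacobian x) (at x within S)"
proof (rule has_derivative_componentwise_within[THEN iffD2], safe)
  fix i :: "real^3" assume "i \<in> Basis"
  then obtain k where k: "i = axis k 1" by (auto simp: Basis_vec_def)
  have nth: "((\<lambda>x::real^3. x $ j) has_derivative (\<lambda>v. v $ j)) (at x within S)" for j
    by (rule bounded_linear_imp_has_derivative) (rule bounded_linear_vec_nth)
  have "((\<lambda>x. spherical_coordinates x $ k) has_derivative (\<lambda>v. spherical_jacobian x v $ k))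
      (at x within S)"
    using exhaust_3[of k]
    by (auto simp: spherical_coordinates_def spherical_jacobian_def
      intro!: derivative_eq_intros nth simp: algebra_simps)
  then show "((\<lambda>x. spherical_coordinates x \<bullet> i) has_derivative (\<lambda>v. spherical_jacobian x v \<bullet> i))
      (at x within S)"
    by (simp add: k inner_axis)
qed

lemma det_spherical_jacobian: "det (matrix (spherical_jacobian x)) = (x$1)\<^sup>2 * sin (x$2)"
proof -
  \<comment> \<open>Sines and cosines become free variables, so that the determinant is a polynomial
    identity; the two sums of squares are 1 for the actual angles.\<close>
  have "det (matrix (\<lambda>v. vector
     [v$1 * (s * c') + r * (v$2 * c * c' - v$3 * s * s'),
      v$1 * (s * s') + r * (v$2 * c * s' + v$3 * s * c'),
      v$1 * c - r * (v$2 * s)] :: real^3)) = r\<^sup>2 * s * (s\<^sup>2 + c\<^sup>2) * (s'\<^sup>2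
          + c'\<^sup>2)" for r s c s' c' :: real
    unfolding det_3 matrix_def
    by (simp add: axis_def algebra_simps power2_eq_square)
  then show ?thesis
    by (simp add: spherical_jacobian_def[abs_def])
qed

text \<open>Open, so that the map is injective and the determinant positive. What its image misses
  of the unit ball (the centre, the polar axis, the half-plane of azimuth 0) lies in the null plane
  \<open>x$2 = 0\<close>.\<close>

definition spherical_box :: "(real^3) set" where
  "spherical_box = {x. 0 < x$1 \<and> x$1 < 1 \<and> 0 < x$2 \<and> x$2 < pi \<and> 0 < x$3 \<and> x$3 < 2*pi}"

text \<open>The norm recovers the radius, and the third component recovers the polar angle because
  cosine is injective on \<open>[0, pi]\<close>. Division by the nonzero sine leaves the azimuth up
  to a multiple of \<open>2 * pi\<close>, and two azimuths in the open interval differ by less than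
  that.\<close>

lemma inj_on_spherical_coordinates: "inj_on spherical_coordinates spherical_box"
proof (rule inj_onI)
  fix x y assume xy: "x \<in> spherical_box" "y \<in> spherical_box"
    and eq: "spherical_coordinates x = spherical_coordinates y"
  have "norm (spherical_coordinates x) = norm (spherical_coordinates y)"
    using eq by simp
  with xy have 1: "x$1 = y$1"
    by (simp add: spherical_coordinates_def spherical_box_def)
  with eq xy have dir: "direction (x$2) (x$3) = direction (y$2) (y$3)"
    by (simp add: spherical_coordinates_def spherical_box_def)
  then have "cos (x$2) = cos (y$2)"
    by (metis direction_nth(3))
  moreover have "0 \<le> x$2" "x$2 \<le> pi" "0 \<le> y$2" "y$2 \<le> pi"
    using xy by (auto simp: spherical_box_def)
  ultimately have 2: "x$2 = y$2"
    by (metis cos_inj_pi)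
  have "sin (y$2) \<noteq> 0"
    using xy sin_gt_zero[of "y$2"] by (auto simp: spherical_box_def)
  then have "cos (x$3) = cos (y$3)" "sin (x$3) = sin (y$3)"
    using arg_cong[OF dir, of "\<lambda>v. v$1"] arg_cong[OF dir, of "\<lambda>v. v$2"] 2 by auto
  then obtain n :: int where n: "x$3 = y$3 + 2 * pi * n"
    using sin_cos_eq_iff[of "x$3" "y$3"] by (auto simp: mult_ac)
  have "\<bar>2 * pi * n\<bar> < 2 * pi"
    using n xy unfolding spherical_box_def by auto
  then have "2 * pi * \<bar>real_of_int n\<bar> < 2 * pi * 1"
    by (simp add: abs_mult)
  then have "\<bar>real_of_int n\<bar> < 1"
    by (rule mult_left_less_imp_less) simp
  then have "n = 0"
    by linarith
  with n have "x$3 = y$3" by simp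
  with 1 2 show "x = y" by (intro vec3_eqI)
qed

text \<open>The condition \<open>x$2 \<noteq> 0\<close> excludes at one stroke radius 0, the poles
  and azimuth 0, where the open box offers no preimage.\<close>

lemma ball_minus_spherical_coordinates_image:
  "x \<in> ball 0 1 \<Longrightarrow> x$2 \<noteq> 0 \<Longrightarrow> x \<in> spherical_coordinates ` spherical_box"
proof -
  assume x: "x \<in> ball 0 1" and x2: "x$2 \<noteq> 0"
  define r where "r = norm x"
  have r: "0 < r" "r < 1" using x x2 by (auto simp: r_def)
  have r2: "r\<^sup>2 = (x$1)\<^sup>2 + (x$2)\<^sup>2 + (x$3)\<^sup>2"
    by (simp add: r_def norm_vec_def L2_set_def sum_3)
  have "(x$3)\<^sup>2 < r\<^sup>2" using r2 x2 zero_less_power2[of "x$2"] zero_le_power2[of "x$1"] by linarith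
  then have "\<bar>x$3\<bar> < r" using r
      by (metis abs_of_pos power2_less_imp_less power2_abs abs_ge_zero less_imp_le)
  then have z: "-1 < x$3 / r" "x$3 / r < 1" using r by (auto simp: field_simps abs_less_iff)
  define \<psi> where "\<psi> = arccos (x$3 / r)"
  have cos: "cos \<psi> = x$3 / r" using z by (simp add: \<psi>_def)
  have psi: "0 < \<psi>" "\<psi> < pi" using arccos_lt_bounded[OF z] by (auto simp: \<psi>_def)
  then have sin: "sin \<psi> > 0" by (rule sin_gt_zero)
  have "(r * sin \<psi>)\<^sup>2 = r\<^sup>2 - (r * cos \<psi>)\<^sup>2"
    by (simp add: power_mult_distrib sin_squared_eq algebra_simps)
  also have "\<dots> = (x$1)\<^sup>2 + (x$2)\<^sup>2" using r2 r cos by simp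
  finally have "(r * sin \<psi>)\<^sup>2 = (x$1)\<^sup>2 + (x$2)\<^sup>2" .
  moreover have "(r * sin \<psi>)\<^sup>2 \<noteq> 0" using r sin by simp
  ultimately have "(x$1 / (r * sin \<psi>))\<^sup>2 + (x$2 / (r * sin \<psi>))\<^sup>2 = 1"
    by (simp only: power_divide add_divide_distrib[symmetric] divide_self_if if_False)
  then obtain \<phi> where phi: "0 \<le> \<phi>" "\<phi> < 2 * pi" "x$1 / (r * sin \<psi>) = cos \<phi>" "x$2 / (r * sin \<psi>) = sin \<phi>"
    by (metis sincos_total_2pi)
  then have "\<phi> \<noteq> 0" using x2 r sin by auto
  have "x = spherical_coordinates (vector [r, \<psi>, \<phi>])"
    by (rule vec3_eqI) (use phi(3,4) cos r sin in \<open>auto simp: spherical_coordinates_def field_simps\<close>)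
  moreover have "vector [r, \<psi>, \<phi>] \<in> spherical_box"
    using r psi phi \<open>\<phi> \<noteq> 0\<close> by (simp add: spherical_box_def)
  ultimately show ?thesis by blast
qed


lemma borel_measurable_vec_nth [measurable]:
  "(\<lambda>x :: real^'n. x $ i) \<in> borel_measurable borel"
  by (intro borel_measurable_continuous_onI continuous_intros)

lemma borel_measurable_spherical_coordinates [measurable]:
  "spherical_coordinates \<in> borel_measurable borel"
  unfolding spherical_coordinates_def[abs_def] by measurable

lemma spherical_box_eq_box: "spherical_box = box 0 (vector [1, pi, 2 * pi])"
  by (auto simp: spherical_box_def mem_box_3)

lemma sets_spherical_box [measurable]: "spherical_box \<in> sets borel"
  by (simp add: spherical_box_eq_box)

text \<open>The measure of an injective differentiable image is the integral of the absolute
  determinant. The image of \<open>T\<close> is obtained as a Lebesgue set, so its comparison with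
  \<open>A \<inter> ball 0 1\<close> runs in the completed measure \<open>lebesgue\<close>; the two
  sets differ inside the plane \<open>x$2 = 0\<close>.\<close>

lemma emeasure_Int_ball_spherical:
  assumes [measurable]: "A \<in> sets borel"
  defines "T \<equiv> spherical_box \<inter> spherical_coordinates -` A"
  shows "emeasure lborel (A \<inter> ball 0 1) = (\<integral>\<^sup>+x. ennreal ((x$1)\<^sup>2 * sin (x$2)) * indicator T x \<partial>lborel)"
proof -
  let ?h = "\<lambda>x :: real^3. (x$1)\<^sup>2 * sin (x$2)"
  have T [measurable]: "T \<in> sets borel"
    unfolding T_def using measurable_sets[OF borel_measurable_spherical_coordinates assms(1)]
    by (simp add: sets.Int)
  \<comment> \<open>\<open>T\<close> has finite measure and the volume factor is at most 1 on it;
    this makes the factor integrable over \<open>T\<close> and supplies the finite value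
    \<open>I\<close>.\<close>
  have "T \<subseteq> box 0 (vector [1, pi, 2 * pi])"
    by (auto simp: T_def spherical_box_eq_box)
  then have "emeasure lborel T \<le> emeasure lborel (box 0 (vector [1, pi, 2 * pi] :: real^3))"
    by (intro emeasure_mono) auto
  also have "\<dots> < \<infinity>" by (rule emeasure_lborel_box_finite)
  finally have fin: "emeasure lborel T < \<infinity>" .
  have bound: "norm (?h x) \<le> 1" if "x \<in> T" for x
    using that abs_sin_le_one[of "x$2"]
    by (auto simp: T_def spherical_box_def abs_mult intro!: mult_le_one power_le_one)
  have nonneg: "0 \<le> ?h x" if "x \<in> T" for x
    using that sin_gt_zero[of "x$2"] by (auto simp: T_def spherical_box_def)
  have int: "integrable lborel (\<lambda>x. indicator T x *\<^sub>R ?h x)"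
    by (rule integrableI_bounded_set_indicator[where B = 1]) (use fin bound in auto)
  define I where "I = (\<integral>x. indicator T x *\<^sub>R ?h x \<partial>lborel)"
  have "((\<lambda>x. indicator T x *\<^sub>R ?h x) has_integral I) UNIV"
    unfolding I_def by (rule has_integral_integral_lborel[OF int])
  also have "(\<lambda>x. indicator T x *\<^sub>R ?h x) = (\<lambda>x. if x \<in> T then ?h x else 0)"
    by (auto simp: fun_eq_iff)
  finally have "(?h has_integral I) T"
    by (simp add: has_integral_restrict_UNIV)
  then have hI: "((\<lambda>x. \<bar>det (matrix (spherical_jacobian x))\<bar>) has_integral I) T"
    by (rule has_integral_eq[rotated]) (use nonneg in \<open>simp add: det_spherical_jacobian\<close>)
  have "T \<in> sets lebesgue" using T by simp
  moreover have "inj_on spherical_coordinates T"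
    by (rule inj_on_subset[OF inj_on_spherical_coordinates]) (simp add: T_def)
  ultimately have "spherical_coordinates ` T \<in> lmeasurable
      \<and> measure lebesgue (spherical_coordinates ` T) = I"
    using has_measure_differentiable_image[of T spherical_coordinates spherical_jacobian I] hI
      has_derivative_spherical_coordinates by blast
  then have img: "spherical_coordinates ` T \<in> sets lebesgue"
    and "emeasure lebesgue (spherical_coordinates ` T) = ennreal I"
    using fmeasurableD2[of "spherical_coordinates ` T" lebesgue]
    by (simp_all only: fmeasurableD emeasure_eq_ennreal_measure not_False_eq_True)
  moreover have "emeasure lebesgue (A \<inter> ball 0 1) = emeasure lebesgue (spherical_coordinates ` T)"
  proof (rule emeasure_eq_AE)
    have "AE x in lebesgue. x \<notin> {x :: real^3. x$2 = 0}"
      by (rule AE_not_in) (use negligible_standard_hyperplane_cart[of 2] in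
          \<open>auto simp: negligible_iff_null_sets\<close>)
    then show "AE x in lebesgue. x \<in> A \<inter> ball 0 1 \<longleftrightarrow> x \<in> spherical_coordinates ` T"
    proof eventually_elim
      case (elim x)
      have "norm (spherical_coordinates y) < 1" if "y \<in> T" for y
        using that by (auto simp: T_def spherical_coordinates_def spherical_box_def)
      with elim ball_minus_spherical_coordinates_image[of x] show ?case
        by (auto simp: T_def)
    qed
  qed (use img in auto)
  moreover have "emeasure lebesgue (A \<inter> ball 0 1) = emeasure lborel (A \<inter> ball 0 1)"
    by simp
  moreover have "ennreal I = (\<integral>\<^sup>+x. ennreal (indicator T x *\<^sub>R ?h x) \<partial>lborel)"
    unfolding I_def using nonneg
    by (intro nn_integral_eq_integral[OF int, symmetric] AE_I2) (auto simp: indicator_def)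
  moreover have "\<dots> = (\<integral>\<^sup>+x. ennreal (?h x) * indicator T x \<partial>lborel)"
    by (intro nn_integral_cong) (auto simp: indicator_def)
  ultimately show ?thesis by simp
qed

lemma AE_lborel_Icc_Ioo:
  "AE x in lborel. indicator {a<..<b} x = (indicator {a..b} x :: 'a::zero_neq_one)" for a b :: real
  using AE_lborel_singleton[of a] AE_lborel_singleton[of b]
  by eventually_elim (auto simp: indicator_def)

lemma nn_integral_square_01: "(\<integral>\<^sup>+r. ennreal (r\<^sup>2) * indicator {0<..<1} r \<partial>lborel) = ennreal (1 / 3)"
proof -
  have "(\<integral>\<^sup>+r. ennreal (r\<^sup>2) * indicator {0<..<1} r \<partial>lborel)
      = (\<integral>\<^sup>+r. ennreal (r\<^sup>2) * indicator {0..1} r \<partial>lborel)"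
    using AE_lborel_Icc_Ioo[of 0 1, where ?'a = ennreal]
        by (intro nn_integral_cong_AE) (auto elim: eventually_mono)
  also have "\<dots> = ennreal (1^3 / 3 - 0^3 / 3)"
    by (rule nn_integral_FTC_Icc)
       (auto intro!: derivative_eq_intros simp: power2_eq_square
           has_real_derivative_iff_has_vector_derivative[symmetric])
  finally show ?thesis by simp
qed

text \<open>The radial projection forgets the radius, so in spherical coordinates the volume of the
  cone over \<open>B\<close> splits into the radial factor \<open>1 / 3\<close> and an angular
  integral \<open>K\<close>. Division by the ball volume gives \<open>1 / (4 * pi)\<close>.\<close>

lemma uniform_sphere_eq:
  "uniform_sphere R = distr (density (lborel \<Otimes>\<^sub>M lborel)
      (\<lambda>(\<psi>, \<phi>). ennreal (sin \<psi> / (4 * pi)) * indicator {0<..<pi} \<psi> * indicator {0<..<2*pi} \<phi>))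
      borel (\<lambda>(\<psi>, \<phi>). R *\<^sub>R direction \<psi> \<phi>)" (is "_ = distr (density _ ?d) _ ?g")
proof (rule measure_eqI)
  fix B assume "B \<in> sets (uniform_sphere R)"
  then have B [measurable]: "B \<in> sets borel" by (simp add: uniform_sphere_def)
  let ?P = "\<lambda>x :: real^3. (R / norm x) *\<^sub>R x"
  have PB [measurable]: "?P -` B \<in> sets borel"
    using measurable_sets[of ?P borel borel B] by simp
  define K where "K = (\<integral>\<^sup>+\<psi>. \<integral>\<^sup>+\<phi>. ennreal (sin \<psi>) * indicator {0<..<pi} \<psi> * indicator {0<..<2*pi} \<phi> *
      indicator B (R *\<^sub>R direction \<psi> \<phi>) \<partial>lborel \<partial>lborel)"
  have "emeasure lborel (?P -` B \<inter> ball 0 1) =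
     (\<integral>\<^sup>+x. ennreal ((x$1)\<^sup>2 * sin (x$2))
         * indicator (spherical_box \<inter> spherical_coordinates -` (?P -` B)) x \<partial>lborel)"
    by (rule emeasure_Int_ball_spherical) measurable
  also have "\<dots> = (\<integral>\<^sup>+x. (ennreal (((x::real^3)$1)\<^sup>2) * indicator {0<..<1} (x$1)) *
      (ennreal (sin (x$2)) * indicator {0<..<pi} (x$2) * indicator {0<..<2*pi} (x$3) *
        indicator B (R *\<^sub>R direction (x$2) (x$3))) \<partial>lborel)"
    by (intro nn_integral_cong)
       (auto simp: spherical_box_def spherical_coordinates_def ennreal_mult' split: split_indicator)
  also have "\<dots> = (\<integral>\<^sup>+r. \<integral>\<^sup>+\<psi>. \<integral>\<^sup>+\<phi>. (ennreal (r\<^sup>2) * indicator {0<..<1} r) *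
      (ennreal (sin \<psi>) * indicator {0<..<pi} \<psi> * indicator {0<..<2*pi} \<phi> *
        indicator B (R *\<^sub>R direction \<psi> \<phi>)) \<partial>lborel \<partial>lborel \<partial>lborel)"
    by (subst nn_integral_lborel_real_3) auto
  also have "\<dots> = (\<integral>\<^sup>+r. (ennreal (r\<^sup>2) * indicator {0<..<1} r) * K \<partial>lborel)"
    by (simp add: nn_integral_cmult K_def)
  also have "\<dots> = ennreal (1 / 3) * K"
    by (simp add: nn_integral_multc nn_integral_square_01)
  finally have *: "emeasure lborel (?P -` B \<inter> ball 0 1) = ennreal (1 / 3) * K" .
  have "emeasure (uniform_sphere R) B = emeasure (uniform_measure lborel (ball 0 1)) (?P -` B)"
    unfolding uniform_sphere_def by (subst emeasure_distr) (simp_all)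
  also have "\<dots> = emeasure lborel (?P -` B \<inter> ball 0 1) / emeasure lborel (ball 0 1 :: (real^3) set)"
    by (subst emeasure_uniform_measure) (simp_all add: Int_commute)
  also have "\<dots> = ennreal (1 / 3) * K / ennreal (4 / 3 * pi)"
    by (simp only: *) (simp add: emeasure_ball unit_ball_vol_3)
  also have "\<dots> = ennreal (1 / (4 * pi)) * K"
  proof -
    have "ennreal (1 / (4 * pi)) = ennreal (1 / 3) / ennreal (4 / 3 * pi)"
      by (subst divide_ennreal) (auto simp: field_simps)
    then show ?thesis
      by (simp add: divide_ennreal_def mult_ac)
  qed
  also have "\<dots> = (\<integral>\<^sup>+\<psi>. \<integral>\<^sup>+\<phi>. ?d (\<psi>, \<phi>) * indicator B (R *\<^sub>R direction \<psi> \<phi>) \<partial>lborel \<partial>lborel)"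
    unfolding K_def
    by (auto simp: nn_integral_cmult[symmetric] ennreal_mult'[symmetric] mult.assoc[symmetric]
        intro!: nn_integral_cong split: split_indicator)
  also have "\<dots> = (\<integral>\<^sup>+p. ?d p * indicator B (?g p) \<partial>(lborel \<Otimes>\<^sub>M lborel))"
    by (subst lborel.nn_integral_fst[symmetric]) (auto simp: case_prod_unfold)
  also have "\<dots> = emeasure (distr (density (lborel \<Otimes>\<^sub>M lborel) ?d) borel ?g) B"
    by (subst nn_integral_indicator[symmetric], simp, subst nn_integral_distr)
       (auto simp: nn_integral_density case_prod_unfold)
  finally show "emeasure (uniform_sphere R) B
      = emeasure (distr (density (lborel \<Otimes>\<^sub>M lborel) ?d) borel ?g) B" .
qed (simp add: uniform_sphere_def)

section \<open>The uniform distribution on the sphere\<close>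

lemma sets_uniform_sphere [measurable_cong, simp]: "sets (uniform_sphere R) = sets borel"
  by (simp add: uniform_sphere_def)

lemma space_uniform_sphere [simp]: "space (uniform_sphere R) = UNIV"
  by (simp add: uniform_sphere_def)

lemma prob_space_uniform_sphere: "prob_space (uniform_sphere R)"
proof -
  interpret prob_space "uniform_measure lborel (ball 0 1 :: (real^3) set)"
    by (rule prob_space_uniform_measure) (auto simp: emeasure_ball unit_ball_vol_3)
  show ?thesis
    unfolding uniform_sphere_def by (rule prob_space_distr) simp
qed

lemma AE_uniform_sphere_norm: "0 \<le> R \<Longrightarrow> AE x in uniform_sphere R. norm x = R"
  by (subst uniform_sphere_eq, subst AE_distr_iff) auto

lemma nn_integral_uniform_sphere:
  assumes [measurable]: "f \<in> borel_measurable borel"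
  shows "(\<integral>\<^sup>+x. f x \<partial>uniform_sphere R) =
    (\<integral>\<^sup>+\<psi>. \<integral>\<^sup>+\<phi>. ennreal (sin \<psi> / (4 * pi)) * indicator {0..pi} \<psi> * indicator {0..2*pi} \<phi> *
        f (R *\<^sub>R direction \<psi> \<phi>) \<partial>lborel \<partial>lborel)"
proof -
  have "(\<integral>\<^sup>+x. f x \<partial>uniform_sphere R) =
    (\<integral>\<^sup>+\<psi>. \<integral>\<^sup>+\<phi>. ennreal (sin \<psi> / (4 * pi)) * indicator {0<..<pi} \<psi> * indicator {0<..<2*pi} \<phi> *
        f (R *\<^sub>R direction \<psi> \<phi>) \<partial>lborel \<partial>lborel)"
    by (subst uniform_sphere_eq, subst nn_integral_distr, simp, simp, subst nn_integral_density,
        simp, simp)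
       (subst lborel.nn_integral_fst[symmetric], auto simp: case_prod_unfold)
  also have "\<dots> = (\<integral>\<^sup>+\<psi>. \<integral>\<^sup>+\<phi>. ennreal (sin \<psi> / (4 * pi)) * indicator {0<..<pi} \<psi>
      * indicator {0..2*pi} \<phi> *
        f (R *\<^sub>R direction \<psi> \<phi>) \<partial>lborel \<partial>lborel)"
    using AE_lborel_Icc_Ioo[of 0 "2 * pi", where ?'a = ennreal]
    by (intro nn_integral_cong nn_integral_cong_AE) (auto elim: eventually_mono)
  also have "\<dots> = (\<integral>\<^sup>+\<psi>. \<integral>\<^sup>+\<phi>. ennreal (sin \<psi> / (4 * pi)) * indicator {0..pi} \<psi> * indicator {0..2*pi} \<phi> *
        f (R *\<^sub>R direction \<psi> \<phi>) \<partial>lborel \<partial>lborel)"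
    using AE_lborel_Icc_Ioo[of 0 "pi", where ?'a = ennreal]
    by (intro nn_integral_cong_AE) (auto elim!: eventually_mono)
  finally show ?thesis .
qed

section \<open>Rotation invariance of the sphere law\<close>

lemma borel_measurable_orthogonal_transformation:
  fixes Q :: "'a::euclidean_space \<Rightarrow> 'a"
  assumes "orthogonal_transformation Q"
  shows "Q \<in> borel_measurable borel"
  using orthogonal_transformation_linear[OF assms]
  by (intro borel_measurable_continuous_onI linear_continuous_on) (simp add: linear_conv_bounded_linear)

text \<open>Boundedness gives both sets finite measure, so invariance of the real-valued
  \<open>measure\<close> under orthogonal images carries over to \<open>emeasure\<close>; by
  surjectivity the image of the preimage is \<open>A\<close> again.\<close>

lemma emeasure_orthogonal_vimage:
  fixes Q :: "real^'n::{finite,wellorder} \<Rightarrow> real^'n::_"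
  assumes Q: "orthogonal_transformation Q" and A: "A \<in> sets borel" and "bounded A"
  shows "emeasure lborel (Q -` A) = emeasure lborel A"
proof -
  have B: "Q -` A \<in> sets borel"
    using measurable_sets[OF borel_measurable_orthogonal_transformation[OF Q] A] by simp
  have "bounded (Q -` A)"
    using \<open>bounded A\<close> orthogonal_transformation_norm[OF Q] unfolding bounded_iff by (metis vimageE)
  then have "Q -` A \<in> lmeasurable"
    using B by (intro bounded_set_imp_lmeasurable) auto
  then have "measure lebesgue (Q ` (Q -` A)) = measure lebesgue (Q -` A)"
    by (rule measure_orthogonal_image[OF Q])
  moreover have "Q ` (Q -` A) = A"
    using orthogonal_transformation_surj[OF Q] by (simp add: surj_image_vimage_eq)
  ultimately have "measure lborel A = measure lborel (Q -` A)"
    using A B by simp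
  moreover have "emeasure lborel A < \<infinity>" "emeasure lborel (Q -` A) < \<infinity>"
    using \<open>bounded A\<close> \<open>bounded (Q -` A)\<close> by (simp_all only: emeasure_bounded_finite)
  ultimately show ?thesis
    by (simp add: emeasure_eq_ennreal_measure)
qed

text \<open>An orthogonal map is linear and preserves norms, hence commutes with the radial
  projection: the cone over a preimage is the preimage of the cone and has the same volume.\<close>

lemma distr_uniform_sphere_orthogonal:
  assumes Q: "orthogonal_transformation Q"
  shows "distr (uniform_sphere R) borel Q = uniform_sphere R"
proof (rule measure_eqI)
  note [measurable] = borel_measurable_orthogonal_transformation[OF Q]
  fix B assume "B \<in> sets (distr (uniform_sphere R) borel Q)"
  then have B [measurable]: "B \<in> sets borel" by simp
  let ?P = "\<lambda>x :: real^3. (R / norm x) *\<^sub>R x"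
  have E: "emeasure (uniform_sphere R) C
      = emeasure lborel (ball 0 1 \<inter> ?P -` C) / emeasure lborel (ball 0 1 :: (real^3) set)"
    if "C \<in> sets borel" for C
  proof -
    have "?P -` C \<in> sets borel" using measurable_sets[of ?P borel borel C] that by simp
    then show ?thesis
      unfolding uniform_sphere_def using that by (simp add: emeasure_distr)
  qed
  have QB: "Q -` B \<in> sets borel" using measurable_sets[of Q borel borel B] by simp
  have "emeasure (distr (uniform_sphere R) borel Q) B = emeasure (uniform_sphere R) (Q -` B)"
    by (simp add: emeasure_distr)
  also have "\<dots> = emeasure lborel (ball 0 1 \<inter> ?P -` (Q -` B)) / emeasure lborel (ball 0 1 :: (real^3)
      set)"
    using QB by (rule E)
  also have "ball 0 1 \<inter> ?P -` (Q -` B) = Q -` (ball 0 1 \<inter> ?P -` B)"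
    using orthogonal_transformation_norm[OF Q] orthogonal_transformation_scaleR[OF Q] by auto
  also have "emeasure lborel \<dots> = emeasure lborel (ball 0 1 \<inter> ?P -` B)"
  proof (rule emeasure_orthogonal_vimage[OF Q])
    have "?P -` B \<in> sets borel" using measurable_sets[of ?P borel borel B] by simp
    then show "ball 0 1 \<inter> ?P -` B \<in> sets borel" by simp
    show "bounded (ball 0 1 \<inter> ?P -` B)" by (meson bounded_Int bounded_ball)
  qed
  also have "emeasure lborel (ball 0 1 \<inter> ?P -` B) / emeasure lborel (ball 0 1 :: (real^3) set)
      = emeasure (uniform_sphere R) B"
    using B by (rule E[symmetric])
  finally show "emeasure (distr (uniform_sphere R) borel Q) B = emeasure (uniform_sphere R) B" .
qed simp

section \<open>Central angles, distances and an adapted orthogonal frame\<close>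

lemma inner_direction:
  "direction \<psi> \<phi> \<bullet> direction \<theta> 0 = sin \<theta> * sin \<psi> * cos \<phi> + cos \<theta> * cos \<psi>"
  by (simp add: inner_vec_def sum_3 mult_ac)

lemma abs_inner_div_norms_le_1: "\<bar>x \<bullet> y / (norm x * norm y)\<bar> \<le> 1" for x y :: "'a::real_inner"
  using Cauchy_Schwarz_ineq2[of x y] by (cases "norm x * norm y
      = 0") (auto simp: abs_mult divide_le_eq_1)

text \<open>Zero vectors are included: the quotient is then 0 by the convention for division and
  still lies in \<open>[-1, 1]\<close>.\<close>

lemma cos_central_angle: "cos (central_angle x y) = x \<bullet> y / (norm x * norm y)"
  using abs_inner_div_norms_le_1[of x y] by (simp add: central_angle_def cos_arccos_abs)

lemma central_angle_bounds: "0 \<le> central_angle x y" "central_angle x y \<le> pi"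
  using arccos_bounded[of "x \<bullet> y / (norm x * norm y)"] abs_inner_div_norms_le_1[of x y]
  unfolding central_angle_def abs_le_iff by linarith+

lemma central_angle_commute: "central_angle x y = central_angle y x"
  by (simp add: central_angle_def inner_commute mult.commute)

text \<open>Gram-Schmidt applied to \<open>c\<close> and \<open>u\<close>, completed by a cross
  product: the direction of \<open>c\<close> becomes the pole, and the part of \<open>u\<close>
  orthogonal to \<open>c\<close> fixes azimuth 0.\<close>

lemma orthogonal_frame:
  fixes c u :: "real^3"
  assumes "c \<noteq> 0" "u \<noteq> 0"
  obtains Q where "orthogonal_transformation Q" "Q (norm c *\<^sub>R direction 0 0) = c"
    "Q (norm u *\<^sub>R direction (central_angle c u) 0) = u"
proof -
  define \<theta> where "\<theta> = central_angle c u"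
  define e3 where "e3 = c /\<^sub>R norm c"
  define v where "v = u /\<^sub>R norm u"
  define w where "w = v - cos \<theta> *\<^sub>R e3"
  have e3: "norm e3 = 1" "e3 \<bullet> e3 = 1" using assms by (simp_all add: e3_def dot_square_norm)
  have v: "v \<bullet> v = 1" using assms by (simp add: v_def dot_square_norm)
  have ve3: "v \<bullet> e3 = cos \<theta>"
    unfolding \<theta>_def cos_central_angle by (simp add: v_def e3_def inner_commute divide_inverse)
  have we3: "w \<bullet> e3 = 0" by (simp add: w_def inner_diff_left ve3 e3)
  have "w \<bullet> w = 1 - (cos \<theta>)\<^sup>2"
    by (simp add: w_def inner_diff_left inner_diff_right ve3 e3 v inner_commute[of e3 v]
        power2_eq_square)
  then have "(norm w)\<^sup>2 = (sin \<theta>)\<^sup>2"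
    by (simp add: power2_norm_eq_inner sin_squared_eq)
  moreover have "0 \<le> sin \<theta>"
    unfolding \<theta>_def by (intro sin_ge_zero central_angle_bounds)
  ultimately have nw: "norm w = sin \<theta>"
    by simp
  obtain e1 where e1: "norm e1 = 1" "e1 \<bullet> e3 = 0" "w = sin \<theta> *\<^sub>R e1"
  proof (cases "w = 0")
    \<comment> \<open>If \<open>u\<close> is parallel to \<open>c\<close>, then
      \<open>sin \<theta>\<close> is 0 and every unit vector orthogonal to \<open>e3\<close> serves;
      one is the image of the first axis under an orthogonal map that takes the third axis to
      \<open>e3\<close>.\<close>
    case True
    obtain f where f: "orthogonal_transformation f" "f (axis 3 1 :: real^3) = e3"
      using orthogonal_transformation_exists[of "axis 3 1 :: real^3" e3] e3(1) by auto
    have "norm (f (axis 1 1)) = 1"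
      using f(1) by (simp add: orthogonal_transformation_norm)
    moreover have "f (axis 1 1) \<bullet> e3 = 0"
      unfolding f(2)[symmetric] using f(1) by (simp add: orthogonal_transformation_def inner_axis_axis)
    ultimately show ?thesis using True nw by (intro that) auto
  next
    case False
    then show ?thesis
      using we3 by (intro that[of "w /\<^sub>R norm w"]) (auto simp flip: nw)
  qed
  define e2 where "e2 = cross3 e3 e1"
  have e2: "e2 \<bullet> e1 = 0" "e2 \<bullet> e3 = 0"
    by (simp_all add: e2_def dot_cross_self)
  have "(norm e2)\<^sup>2 = 1"
    using norm_cross_dot[of e3 e1] e1 e3 by (simp add: e2_def inner_commute)
  then have ne2: "e2 \<bullet> e2 = 1" by (simp add: power2_norm_eq_inner)
  have ne1: "e1 \<bullet> e1 = 1" using e1(1) by (simp add: dot_square_norm)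
  define Q where "Q x = (x$1) *\<^sub>R e1 + (x$2) *\<^sub>R e2 + (x$3) *\<^sub>R e3" for x :: "real^3"
  have "linear Q"
    by (rule linearI) (simp_all add: Q_def algebra_simps)
  moreover have "norm (Q x) = norm x" for x
  proof -
    have "Q x \<bullet> Q x = x \<bullet> x"
      using e1(2) e2 ne1 ne2 e3(2)
          by (simp add: Q_def inner_add_left inner_add_right inner_commute inner_vec_def[of x x] sum_3)
    then show ?thesis by (simp add: norm_eq_sqrt_inner)
  qed
  ultimately have "orthogonal_transformation Q"
    by (simp add: orthogonal_transformation)
  moreover have "Q (norm c *\<^sub>R direction 0 0) = c"
    using assms by (simp add: Q_def e3_def)
  moreover have "Q (norm u *\<^sub>R direction \<theta> 0) = norm u *\<^sub>R (w + cos \<theta> *\<^sub>R e3)"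
    by (simp add: Q_def e1(3) algebra_simps)
  then have "Q (norm u *\<^sub>R direction \<theta> 0) = u"
    using assms by (simp add: w_def v_def)
  ultimately show ?thesis by (intro that[of Q]) (auto simp: \<theta>_def)
qed

lemma dist_power2: "(dist x y)\<^sup>2 = (norm x)\<^sup>2 + (norm y)\<^sup>2 - 2 * (x \<bullet> y)" for x y :: "'a::real_inner"
  by (simp add: dist_norm power2_norm_eq_inner inner_diff_left inner_diff_right inner_commute)

lemma dist_eq_r_LU:
  assumes "x \<noteq> 0" "y \<noteq> 0"
  shows "dist x y = r_LU (norm y) (norm x) (central_angle x y)"
proof -
  have "(dist x y)\<^sup>2 = (norm x)\<^sup>2 + (norm y)\<^sup>2 - 2 * norm x * norm y * cos (central_angle x y)"
    unfolding cos_central_angle dist_power2 using assms by simp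
  then show ?thesis
    unfolding r_LU_def by (metis abs_of_nonneg real_sqrt_abs zero_le_dist)
qed

text \<open>\<open>Q\<close> preserves inner products, so the distances follow from the law of
  cosines for the model vectors. The central angle needs \<open>\<psi>\<close> in
  \<open>[0, pi]\<close>, where \<open>arccos\<close> inverts cosine.\<close>

lemma spherical_frame:
  assumes Q: "orthogonal_transformation Q" "Q (R *\<^sub>R direction 0 0) = c" "Q (r *\<^sub>R direction \<theta> 0) = u"
    and R: "0 < R" and r: "0 < r"
  defines "x \<equiv> \<lambda>\<psi> \<phi>. Q (R *\<^sub>R direction \<psi> \<phi>)"
  shows "norm (x \<psi> \<phi>) = R" "dist c (x \<psi> \<phi>) = r_LF R \<psi>" "dist (x \<psi> \<phi>) u = r_FU r R \<theta> \<psi> \<phi>"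
    "0 \<le> \<psi> \<Longrightarrow> \<psi> \<le> pi \<Longrightarrow> central_angle c (x \<psi> \<phi>) = \<psi>"
proof -
  show n: "norm (x \<psi> \<phi>) = R"
    using R by (simp add: x_def orthogonal_transformation_norm[OF Q(1)])
  have nc: "norm c = R" and nu: "norm u = r"
    using R r Q by (metis abs_of_pos mult.right_neutral norm_direction norm_scaleR
        orthogonal_transformation_norm)+
  have inn: "Q a \<bullet> Q b = a \<bullet> b" for a b
    using Q(1) by (simp add: orthogonal_transformation_def)
  have cx: "c \<bullet> x \<psi> \<phi> = R\<^sup>2 * cos \<psi>"
    unfolding Q(2)[symmetric] x_def inn using inner_direction[of \<psi> \<phi> 0]
    by (simp add: power2_eq_square inner_commute)
  have xu: "x \<psi> \<phi> \<bullet> u = R * r * (sin \<theta> * sin \<psi> * cos \<phi> + cos \<theta> * cos \<psi>)"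
    unfolding Q(3)[symmetric] x_def inn by (simp add: inner_direction)
  have "dist c (x \<psi> \<phi>) = sqrt ((dist c (x \<psi> \<phi>))\<^sup>2)" by simp
  also have "\<dots> = sqrt (R\<^sup>2 * (2 * (1 - cos \<psi>)))"
    by (simp add: dist_power2 n nc cx algebra_simps)
  also have "\<dots> = r_LF R \<psi>" using R by (simp only: real_sqrt_mult r_LF_def) simp
  finally show "dist c (x \<psi> \<phi>) = r_LF R \<psi>" .
  have "dist (x \<psi> \<phi>) u = sqrt ((dist (x \<psi> \<phi>) u)\<^sup>2)" by simp
  also have "\<dots> = r_FU r R \<theta> \<psi> \<phi>"
    unfolding dist_power2 n nu xu r_FU_def by (simp add: algebra_simps)
  finally show "dist (x \<psi> \<phi>) u = r_FU r R \<theta> \<psi> \<phi>" .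
  show "central_angle c (x \<psi> \<phi>) = \<psi>" if "0 \<le> \<psi>" "\<psi> \<le> pi"
    using that R by (simp add: central_angle_def cx nc n power2_eq_square arccos_cos)
qed

lemma borel_measurable_arccos [measurable]: "arccos \<in> borel_measurable borel"
proof -
  \<comment> \<open>Outside \<open>[-1, 1]\<close> the defining description of \<open>arccos\<close>
    has no solution, so all these values are the same unspecified real; the argument
    \<open>2\<close> represents it.\<close>
  have "arccos x = arccos 2" if "x \<notin> {-1..1}" for x :: real
  proof -
    have "cos y \<noteq> x" and "cos y \<noteq> 2" for y
      using that cos_le_one[of y] cos_ge_minus_one[of y] unfolding atLeastAtMost_iff by linarith+
    then show ?thesis by (simp only: arccos_def simp_thms)
  qed
  then have "arccos = (\<lambda>x. if x \<in> {-1..1} then arccos x else arccos 2)" by metis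
  also have "\<dots> \<in> borel_measurable borel"
    by (intro borel_measurable_continuous_on_if continuous_on_arccos') auto
  finally show ?thesis .
qed

lemma borel_measurable_central_angle [measurable]:
  assumes [measurable]: "f \<in> borel_measurable M" "g \<in> borel_measurable M"
  shows "(\<lambda>x. central_angle (f x) (g x)) \<in> borel_measurable M"
  unfolding central_angle_def by measurable

text \<open>\<open>K\<close> takes the scalars that the rates see. By rotation invariance
  \<open>x\<close> may be replaced by \<open>Q x\<close>, and in the adapted frame these scalars are
  explicit in the spherical coordinates of \<open>x\<close>.\<close>

lemma nn_integral_uniform_sphere_frame:
  assumes [measurable]: "case_prod (case_prod K) \<in> borel_measurable ((borel \<Otimes>\<^sub>M borel) \<Otimes>\<^sub>M borel)"
    and c: "norm c = R" and u: "u \<noteq> 0" and R: "0 < R"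
  shows "(\<integral>\<^sup>+x. K (central_angle c x) (dist c x) (dist x u) \<partial>uniform_sphere R) =
    (\<integral>\<^sup>+\<psi>. \<integral>\<^sup>+\<phi>. ennreal (sin \<psi> / (4 * pi)) * indicator {0..pi} \<psi> * indicator {0..2*pi} \<phi> *
        K \<psi> (r_LF R \<psi>) (r_FU (norm u) R (central_angle c u) \<psi> \<phi>) \<partial>lborel \<partial>lborel)"
proof -
  have "c \<noteq> 0" using c R by auto
  from orthogonal_frame[OF this u] c obtain Q where Q: "orthogonal_transformation Q"
    "Q (R *\<^sub>R direction 0 0) = c" "Q (norm u *\<^sub>R direction (central_angle c u) 0) = u"
    by metis
  have "0 < norm u" using u by simp
  note fr = spherical_frame[OF Q R this]
  note [measurable] = borel_measurable_orthogonal_transformation[OF Q(1)]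
  have K [measurable]: "(\<lambda>x. K (f x) (g x) (h x)) \<in> borel_measurable N"
    if [measurable]: "f \<in> borel_measurable N" "g \<in> borel_measurable N" "h \<in> borel_measurable N"
    for f g h and N :: "'z measure"
    using measurable_compose[of "\<lambda>x. ((f x, g x), h x)", OF _ assms(1)] by simp
  have "(\<integral>\<^sup>+x. K (central_angle c x) (dist c x) (dist x u) \<partial>uniform_sphere R)
      = (\<integral>\<^sup>+x. K (central_angle c x) (dist c x) (dist x u) \<partial>distr (uniform_sphere R) borel Q)"
    by (simp add: distr_uniform_sphere_orthogonal[OF Q(1)])
  also have "\<dots> = (\<integral>\<^sup>+x. K (central_angle c (Q x)) (dist c (Q x)) (dist (Q x) u) \<partial>uniform_sphere R)"
    by (subst nn_integral_distr) auto
  also have "\<dots> = (\<integral>\<^sup>+\<psi>. \<integral>\<^sup>+\<phi>. ennreal (sin \<psi> / (4 * pi)) * indicator {0..pi} \<psi> * indicator {0..2*pi} \<phi> *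
        K (central_angle c (Q (R *\<^sub>R direction \<psi> \<phi>))) (dist c (Q (R *\<^sub>R direction \<psi> \<phi>)))
          (dist (Q (R *\<^sub>R direction \<psi> \<phi>)) u) \<partial>lborel \<partial>lborel)"
    by (subst nn_integral_uniform_sphere) auto
  also have "\<dots> = (\<integral>\<^sup>+\<psi>. \<integral>\<^sup>+\<phi>. ennreal (sin \<psi> / (4 * pi)) * indicator {0..pi} \<psi> * indicator {0..2*pi} \<phi> *
        K \<psi> (r_LF R \<psi>) (r_FU (norm u) R (central_angle c u) \<psi> \<phi>) \<partial>lborel \<partial>lborel)"
    by (intro nn_integral_cong) (auto simp: fr split: split_indicator)
  finally show ?thesis .
qed

lemma nn_integral_uniform_sphere_central_angle:
  assumes [measurable]: "h \<in> borel_measurable borel" and u: "u \<noteq> 0" and R: "0 < R"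
  shows "(\<integral>\<^sup>+x. h (central_angle u x) \<partial>uniform_sphere R) =
    (\<integral>\<^sup>+\<psi>. ennreal (sin \<psi> / 2) * indicator {0..pi} \<psi> * h \<psi> \<partial>lborel)"
proof -
  \<comment> \<open>The frame lemma needs a pole on the sphere of radius \<open>R\<close>, and
    rescaling \<open>u\<close> changes no central angle. The free azimuth then contributes
    \<open>2 * pi\<close>, which turns \<open>1 / (4 * pi)\<close> into
    \<open>1 / 2\<close>.\<close>
  define c where "c = (R / norm u) *\<^sub>R u"
  have c: "norm c = R" using u R by (simp add: c_def)
  have "central_angle u x = central_angle c x" for x
    using u R by (simp add: central_angle_def c_def)
  then have "(\<integral>\<^sup>+x. h (central_angle u x) \<partial>uniform_sphere R) =
     (\<integral>\<^sup>+x. (\<lambda>\<psi> _ _. h \<psi>) (central_angle c x) (dist c x) (dist x u) \<partial>uniform_sphere R)"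
    by simp
  also have "\<dots> = (\<integral>\<^sup>+\<psi>. \<integral>\<^sup>+\<phi>. (ennreal (sin \<psi> / (4 * pi)) * indicator {0..pi} \<psi> * h \<psi>)
      * indicator {0..2*pi} \<phi>
        \<partial>lborel \<partial>lborel)"
    by (subst nn_integral_uniform_sphere_frame[OF _ c u R]) (auto simp: case_prod_unfold mult_ac)
  also have "\<dots> = (\<integral>\<^sup>+\<psi>. ennreal (sin \<psi> / 2) * indicator {0..pi} \<psi> * h \<psi> \<partial>lborel)"
  proof (intro nn_integral_cong)
    fix \<psi> :: real
    have "ennreal (sin \<psi> / (4 * pi)) * ennreal (2 * pi) = ennreal (sin \<psi> / 2)"
      by (subst ennreal_mult''[symmetric]) auto
    then show "(\<integral>\<^sup>+\<phi>. (ennreal (sin \<psi> / (4 * pi)) * indicator {0..pi} \<psi> * h \<psi>)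
        * indicator {0..2*pi} \<phi> \<partial>lborel)
       = ennreal (sin \<psi> / 2) * indicator {0..pi} \<psi> * h \<psi>"
      by (subst nn_integral_cmult) (simp_all add: mult_ac flip: \<open>_ = ennreal (sin \<psi> / 2)\<close>)
  qed
  finally show ?thesis .
qed

section \<open>Shadowed-Rician fading\<close>

text \<open>The lower incomplete gamma integral is \<open>z!\<close> times the distribution function
  of the Erlang law of shape \<open>z + 1\<close>; the index of \<open>erlang_density\<close> is the
  exponent, one less than the shape.\<close>

lemma nn_integral_power_exp_Icc:
  "(\<integral>\<^sup>+t. ennreal (indicator {0..a} t * (t ^ z * exp (- t))) \<partial>lborel) = ennreal (fact z
      * erlang_CDF z 1 a)"
proof -
  have "(\<integral>\<^sup>+t. ennreal (indicator {0..a} t * (t ^ z * exp (- t))) \<partial>lborel)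
      = (\<integral>\<^sup>+t. ennreal (fact z) * (ennreal (erlang_density z 1 t) * indicator {..a} t) \<partial>lborel)"
    by (intro nn_integral_cong)
       (auto simp: erlang_density_def ennreal_mult''[symmetric] split: split_indicator)
  also have "\<dots> = ennreal (fact z) * ennreal (erlang_CDF z 1 a)"
    by (subst nn_integral_cmult) (auto simp: nn_integral_erlang_density)
  finally show ?thesis
    by (simp add: ennreal_mult'')
qed

lemma set_integral_power_exp_Icc:
  "(LBINT t:{0..a}. t ^ z * exp (- t)) = fact z * erlang_CDF z 1 a"
  unfolding set_lebesgue_integral_def real_scaleR_def
  by (rule integral_eq_nn_integral[THEN trans])
     (auto simp: nn_integral_power_exp_Icc simp del: nn_integral_indicator split: split_indicator)

text \<open>\<open>Gamma (z + 1)\<close> is \<open>z!\<close> and cancels the factorial produced by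
  the incomplete gamma integral; the scaling by \<open>2 * b0\<close> becomes the Erlang
  rate.\<close>

lemma shadowed_rician_cdf_eq:
  fixes \<Omega> b0 m :: real
  assumes "b0 > 0"
  defines "x \<equiv> \<Omega> / (2 * b0 * m + \<Omega>)"
  shows "shadowed_rician_cdf \<Omega> b0 m w =
     (2 * b0 * m / (2 * b0 * m + \<Omega>)) powr m *
       (\<Sum>z. pochhammer m z / fact z * x ^ z * erlang_CDF z (1 / (2 * b0)) w)"
proof -
  have "pochhammer m z / (fact z * Gamma (real z + 1)) * x ^ z * (LBINT t:{0..w / (2 * b0)}. t ^ z
      * exp (- t))
     = pochhammer m z / fact z * x ^ z * erlang_CDF z (1 / (2 * b0)) w" for z
    using erlang_CDF_transform[of "1 / (2 * b0)" z w] assms(1)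
    by (simp add: set_integral_power_exp_Icc Gamma_fact[symmetric] add.commute)
  then show ?thesis
    by (simp add: shadowed_rician_cdf_def x_def)
qed

text \<open>Up to the factor \<open>(1 - x) powr m\<close> the coefficients are negative-binomial
  probabilities; the extra \<open>z + 1\<close> is the mean of an Erlang variable of shape
  \<open>z + 1\<close> and rate 1. Successive quotients tend to \<open>x\<close>, so they eventually
  stay below the midpoint \<open>(1 + x) / 2\<close> of \<open>x\<close> and 1.\<close>

lemma summable_negative_binomial_mean:
  fixes m x :: real
  assumes "m > 0" "0 < x" "x < 1"
  shows "summable (\<lambda>z. pochhammer m z / fact z * x ^ z * real (z + 1))"
proof -
  let ?f = "\<lambda>z. pochhammer m z / fact z * x ^ z * real (z + 1)"
  have pos: "pochhammer m z > 0" for z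
    using assms by (intro pochhammer_pos)
  have "(\<lambda>z. (1 + (m - 1) * inverse (real (Suc z))) * (1 + inverse (real (Suc z))) * x) \<longlonglongrightarrow> (1
      + (m - 1) * 0) * (1 + 0) * x"
    by (intro tendsto_intros LIMSEQ_inverse_real_of_nat)
  then have "eventually (\<lambda>z. (1 + (m - 1) * inverse (real (Suc z))) * (1 + inverse (real (Suc z)))
      * x < (1 + x) / 2) sequentially"
    using assms by (intro order_tendstoD(2)) auto
  then obtain N where N: "\<And>z. z \<ge> N \<Longrightarrow> (1 + (m - 1) * inverse (real (Suc z))) * (1
      + inverse (real (Suc z))) * x < (1 + x) / 2"
    by (auto simp: eventually_sequentially)
  show ?thesis
  proof (rule summable_ratio_test)
    show "(1 + x) / 2 < 1" using assms by simp
    fix z assume "z \<ge> N"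
    have "?f (Suc z) = (1 + (m - 1) * inverse (real (Suc z))) * (1 + inverse (real (Suc z))) * x * ?f z"
      by (simp add: pochhammer_Suc divide_simps)
    also have "\<dots> \<le> (1 + x) / 2 * ?f z"
      using N[OF \<open>z \<ge> N\<close>] pos[of z] assms by (intro mult_right_mono) auto
    finally show "norm (?f (Suc z)) \<le> (1 + x) / 2 * norm (?f z)"
      using pos[of z] pos[of "Suc z"] assms by simp
  qed
qed

text \<open>\<open>(l * x) ^ k / k!\<close> is a single term of the exponential series of
  \<open>l * x\<close>. The bound is uniform in \<open>k\<close>, so a mixture of these densities
  with summable weights converges at every point.\<close>

lemma erlang_density_le:
  assumes "0 < l"
  shows "erlang_density k l x \<le> l"
proof (cases "x < 0")
  case False
  then have "(l * x) ^ k / fact k \<le> exp (l * x)"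
  proof -
    have "(\<Sum>n\<in>{k}. (l * x) ^ n /\<^sub>R fact n) \<le> (\<Sum>n. (l * x) ^ n /\<^sub>R fact n)"
      using False assms by (intro sum_le_suminf summable_exp_generic) auto
    then show ?thesis
      by (simp add: exp_def divide_inverse mult.commute)
  qed
  then have "l * ((l * x) ^ k / fact k * exp (- (l * x))) \<le> l * 1"
    using assms by (intro mult_left_mono) (auto simp: exp_minus field_simps)
  then show ?thesis
    using False by (simp add: erlang_density_def power_mult_distrib mult_ac)
qed (use assms in \<open>simp add: erlang_density_def\<close>)

text \<open>A shadowed-Rician power is a negative-binomial mixture of Erlang variables.\<close>

lemma (in prob_space) nn_integral_shadowed_rician_finite:
  assumes X [measurable]: "X \<in> borel_measurable M"
    and nonneg: "\<And>\<omega>. \<omega> \<in> space M \<Longrightarrow> X \<omega> \<ge> 0"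
    and cdf: "\<And>w. w \<ge> 0 \<Longrightarrow> prob {\<omega>\<in>space M. X \<omega> \<le> w} = shadowed_rician_cdf \<Omega> b0 m w"
    and par: "\<Omega> > 0" "b0 > 0" "m > 0"
  shows "(\<integral>\<^sup>+\<omega>. ennreal (X \<omega>) \<partial>M) < \<infinity>"
proof -
  define x where "x = \<Omega> / (2 * b0 * m + \<Omega>)"
  \<comment> \<open>This is \<open>(1 - x) powr m\<close>, the normalising factor of the
    negative-binomial weights.\<close>
  define p where "p = (2 * b0 * m / (2 * b0 * m + \<Omega>)) powr m"
  define l where "l = 1 / (2 * b0)"
  define a where "a z = p * (pochhammer m z / fact z * x ^ z)" for z
  have l: "l > 0" and x: "0 < x" "x < 1" and p: "p \<ge> 0"
    using par by (auto simp: l_def x_def p_def field_simps add_pos_pos)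
  have a: "a z \<ge> 0" for z
    using x p par pochhammer_pos[of m z] by (simp add: a_def)
  have "summable (\<lambda>z. p * (pochhammer m z / fact z * x ^ z * real (z + 1)))"
    using par x by (intro summable_mult summable_negative_binomial_mean) auto
  then have sum1: "summable (\<lambda>z. a z * real (z + 1))"
    by (simp add: a_def mult.assoc)
  have sum: "summable a"
  proof (rule summable_comparison_test'[OF sum1, of 0])
    show "norm (a z) \<le> a z * real (z + 1)" for z
      using a[of z] by (simp add: distrib_left)
  qed
  define f where "f w = (\<Sum>z. a z * erlang_density z l w)" for w
  have summ: "summable (\<lambda>z. a z * erlang_density z l w)" for w
  proof (rule summable_comparison_test'[OF summable_mult2[OF sum, of l], of 0])
    show "norm (a z * erlang_density z l w) \<le> a z * l" for z
      using a[of z] erlang_density_le[OF l, of z w] l by (simp add: abs_mult mult_left_mono)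
  qed
  have f_eq: "ennreal (f w) = (\<Sum>z. ennreal (a z * erlang_density z l w))" for w
    unfolding f_def using a l by (intro suminf_ennreal2[symmetric] summ) auto
  have [measurable]: "f \<in> borel_measurable borel"
    unfolding f_def[abs_def] by measurable
  have fpos: "0 \<le> f w" for w
    unfolding f_def using a l by (intro suminf_nonneg summ) auto
  have CDF1: "erlang_CDF z l w \<le> 1" for z w
    using l by (auto simp: erlang_CDF_def intro!: sum_nonneg)
  have sumC: "summable (\<lambda>z. a z * erlang_CDF z l w)" for w
    by (rule summable_comparison_test'[OF sum, of 0])
       (use a l CDF1 in \<open>auto simp: abs_mult intro!: mult_left_le\<close>)
  \<comment> \<open>A nonnegative function whose integral up to each \<open>w\<close> is the
    distribution function is a density. Termwise integration of the mixture yields the series of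
    Erlang distribution functions; for negative \<open>w\<close> both sides vanish because
    \<open>X\<close> is nonnegative.\<close>
  have distr: "distributed M lborel X f"
  proof (rule distributedI_borel_atMost)
    fix w :: real
    let ?g = "\<lambda>w. \<Sum>z. a z * erlang_CDF z l w"
    have "(\<integral>\<^sup>+t. ennreal (f t * indicator {..w} t) \<partial>lborel)
        = (\<integral>\<^sup>+t. (\<Sum>z. ennreal (a z) * (ennreal (erlang_density z l t) * indicator {..w} t)) \<partial>lborel)"
      using a l fpos by (intro nn_integral_cong)
          (simp add: f_eq ennreal_mult ennreal_indicator mult.assoc[symmetric]
          flip: ennreal_suminf_multc)
    also have "\<dots> = (\<Sum>z. ennreal (a z) * ennreal (erlang_CDF z l w))"
      using l by (simp add: nn_integral_suminf nn_integral_cmult nn_integral_erlang_density)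
    also have "\<dots> = ennreal (?g w)"
      using a l by (subst suminf_ennreal2[symmetric]) (auto simp: ennreal_mult sumC)
    finally show "(\<integral>\<^sup>+t. ennreal (f t * indicator {..w} t) \<partial>lborel) = ennreal (?g w)" .
    show "emeasure M {\<omega>\<in>space M. X \<omega> \<le> w} = ennreal (?g w)"
    proof (cases "w \<ge> 0")
      case True
      have "?g w = p * (\<Sum>z. pochhammer m z / fact z * x ^ z * erlang_CDF z l w)"
      proof (cases "p = 0")
        case False
        then have "summable (\<lambda>z. (1 / p) * (a z * erlang_CDF z l w))" by (intro summable_mult sumC)
        then have "summable (\<lambda>z. pochhammer m z / fact z * x ^ z * erlang_CDF z l w)"
          using False by (simp add: a_def mult.assoc)
        then show ?thesis
          by (simp add: a_def suminf_mult[symmetric] mult.assoc)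
      qed (simp add: a_def)
      also have "\<dots> = shadowed_rician_cdf \<Omega> b0 m w"
        using par by (simp add: shadowed_rician_cdf_eq x_def p_def l_def)
      finally show ?thesis
        using cdf[OF True] by (simp add: emeasure_eq_measure)
    next
      case False
      then have "{\<omega>\<in>space M. X \<omega> \<le> w} = {}" using nonneg by fastforce
      then show ?thesis using False by (simp only: emeasure_empty) (simp add: erlang_CDF_def)
    qed
  qed (use fpos in auto)
  have "(\<integral>\<^sup>+\<omega>. ennreal (X \<omega>) \<partial>M) = (\<integral>\<^sup>+w. ennreal (f w) * ennreal w \<partial>lborel)"
    by (rule distributed_nn_integral[OF distr, symmetric]) simp
  also have "\<dots> = (\<integral>\<^sup>+w. (\<Sum>z. ennreal (a z) * ennreal (erlang_density z l w * w ^ 1)) \<partial>lborel)"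
    using a l by (intro nn_integral_cong)
      (simp add: f_eq ennreal_mult ennreal_mult' mult.assoc[symmetric] flip: ennreal_suminf_multc)
  \<comment> \<open>The first moment of an Erlang variable of shape \<open>z + 1\<close> and rate
    \<open>l\<close> is \<open>(z + 1) / l\<close>, so the mean of the mixture is a multiple of the
    series \<open>sum1\<close>.\<close>
  also have "\<dots> = (\<Sum>z. ennreal (a z) * ennreal (fact (z + 1) / (fact z * l ^ 1)))"
    using l by (subst nn_integral_suminf, measurable, subst nn_integral_cmult, measurable)
       (simp only: nn_integral_erlang_ith_moment)
  also have "\<dots> = (\<Sum>z. ennreal (a z * real (z + 1) * (1 / l)))"
    using a l by (intro suminf_cong) (simp add: ennreal_mult''[symmetric] field_simps)
  also have "\<dots> = ennreal (\<Sum>z. a z * real (z + 1) * (1 / l))"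
    using a l by (intro suminf_ennreal2 summable_mult2 sum1) auto
  also have "\<dots> < \<infinity>" by simp
  finally show ?thesis .
qed

section \<open>Associated leader and followers\<close>

lemma one_plus_cos_nonneg: "0 \<le> 1 + cos x" for x :: real
  using cos_ge_minus_one[of x] by linarith

lemma nearest_in_range:
  assumes "n \<ge> 1"
  shows "nearest n x u \<in> {1..n}" "\<And>k. k \<in> {1..n} \<Longrightarrow> dist (x (nearest n x u)) u \<le> dist (x k) u"
proof -
  let ?d = "\<lambda>j. dist (x j) u"
  have "{1..n} \<noteq> {}" using assms by simp
  then have "\<exists>j\<in>{1..n}. \<forall>k\<in>{1..n}. ?d j \<le> ?d k"
    using arg_min_if_finite[of "{1..n}" ?d] by (metis finite_atLeastAtMost linorder_not_le)
  then obtain j where "j \<in> {1..n} \<and> (\<forall>k\<in>{1..n}. ?d j \<le> ?d k)" by blast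
  from LeastI[of "\<lambda>j. j \<in> {1..n} \<and> (\<forall>k\<in>{1..n}. ?d j \<le> ?d k)", OF this]
  show "nearest n x u \<in> {1..n}" "\<And>k. k \<in> {1..n} \<Longrightarrow> dist (x (nearest n x u)) u \<le> dist (x k) u"
    by (auto simp: nearest_def)
qed

lemma nearest_cong:
  "(\<And>k. k \<in> {1..n} \<Longrightarrow> x k = y k) \<Longrightarrow> nearest n x u = nearest n y u"
  unfolding nearest_def by (rule arg_cong[where f = Least]) (auto simp: fun_eq_iff)

text \<open>The nearest index is a \<open>LEAST\<close> over measurable comparisons of distances,
  and selection by a measurable index with countable range is measurable. The index is taken into
  \<open>{1..n}\<close>, the components that the product space carries.\<close>

lemma measurable_nearest_point:
  assumes "n \<ge> 1"
  shows "(\<lambda>x. x (nearest n x u)) \<in> borel_measurable (PiM {1..n} (\<lambda>_. borel))"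
proof (rule measurable_compose_countable')
  let ?M = "PiM {1..n} (\<lambda>_. borel) :: (nat \<Rightarrow> real^3) measure"
  have "(\<lambda>x. j \<in> {1..n} \<and> (\<forall>k\<in>{1..n}. dist (x j) u
      \<le> dist (x k) u)) \<in> measurable ?M (count_space UNIV)" for j
  proof (cases "j \<in> {1..n}")
    case True
    have "(\<lambda>x. \<forall>k\<in>{1..n}. dist (x j) u \<le> dist (x k) u) \<in> measurable ?M (count_space UNIV)"
    proof (intro pred_intros_finite)
      fix k assume k: "k \<in> {1..n}"
      have "(\<lambda>x. dist (x i) u) \<in> borel_measurable ?M" if "i \<in> {1..n}" for i
        by (rule borel_measurable_dist[OF measurable_component_singleton[OF that]]) simp
      from this[OF True] this[OF k]
      show "(\<lambda>x. dist (x j) u \<le> dist (x k) u) \<in> measurable ?M (count_space UNIV)"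
        unfolding pred_def by (rule borel_measurable_le)
    qed simp
    then show ?thesis using True by simp
  next
    case False
    then have "(\<lambda>x. j \<in> {1..n} \<and> (\<forall>k\<in>{1..n}. dist (x j) u \<le> dist (x k) u)) = (\<lambda>_. False)" by blast
    then show ?thesis by simp
  qed
  then have "(\<lambda>x. nearest n x u) \<in> measurable ?M (count_space UNIV)"
    unfolding nearest_def by (rule measurable_Least)
  then show "(\<lambda>x. nearest n x u) \<in> measurable ?M (count_space {1..n})"
    using nearest_in_range[OF assms] by (simp add: measurable_count_space_eq2_countable)
qed auto

text \<open>The angle lives on \<open>[0, pi]\<close>, so a threshold outside acts like the nearer
  endpoint; hence the clamped \<open>a'\<close>. The antiderivative of \<open>sin \<psi> / 2\<close>
  is \<open>- cos \<psi> / 2\<close>.\<close>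

lemma emeasure_uniform_sphere_angle_gt:
  fixes a :: real
  defines "a' \<equiv> max 0 (min a pi)"
  assumes "u \<noteq> 0" "0 < R"
  shows "emeasure (uniform_sphere R) {x. a < central_angle x u} = ennreal ((1 + cos a') / 2)"
proof -
  have "emeasure (uniform_sphere R) {x. a < central_angle x u}
      = (\<integral>\<^sup>+x. indicator {a<..} (central_angle u x) \<partial>uniform_sphere R)"
    by (subst nn_integral_indicator[symmetric])
       (auto intro!: nn_integral_cong simp: central_angle_commute[of _ u] simp del: nn_integral_indicator
         split: split_indicator)
  also have "\<dots> = (\<integral>\<^sup>+\<psi>. ennreal (sin \<psi> / 2) * indicator {0..pi} \<psi> * indicator {a<..} \<psi> \<partial>lborel)"
    using assms by (intro nn_integral_uniform_sphere_central_angle) auto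
  also have "\<dots> = (\<integral>\<^sup>+\<psi>. ennreal (sin \<psi> / 2) * indicator {a'..pi} \<psi> \<partial>lborel)"
    \<comment> \<open>The two domains of integration differ at most in the points \<open>a'\<close>
      and \<open>pi\<close>.\<close>
    using AE_lborel_singleton[of a'] AE_lborel_singleton[of pi]
    by (intro nn_integral_cong_AE, eventually_elim) (auto simp: a'_def split: split_indicator)
  also have "\<dots> = ennreal (- cos pi / 2 - (- cos a' / 2))"
    by (rule nn_integral_FTC_Icc)
       (auto simp: a'_def has_real_derivative_iff_has_vector_derivative[symmetric]
             intro!: derivative_eq_intros sin_ge_zero)
  finally show ?thesis by (simp add: add_divide_distrib)
qed

text \<open>Almost every point has norm \<open>R\<close>, so up to a null set the cap is the
  complement of the event that the angle exceeds \<open>\<theta>cap\<close>.\<close>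

lemma emeasure_spherical_cap:
  assumes c: "c \<noteq> 0" and R: "0 < R" and th: "0 \<le> \<theta>cap" "\<theta>cap \<le> pi"
  shows "emeasure (uniform_sphere R) (spherical_cap R \<theta>cap c) = ennreal ((1 - cos \<theta>cap) / 2)"
proof -
  interpret prob_space "uniform_sphere R" by (rule prob_space_uniform_sphere)
  have "AE x in uniform_sphere R. x \<in> spherical_cap R \<theta>cap c \<longleftrightarrow> x \<in> UNIV - {x. \<theta>cap < central_angle x c}"
    using AE_uniform_sphere_norm[of R] R
    by (auto simp: spherical_cap_def central_angle_commute[of _ c] elim!: eventually_mono)
  then have "emeasure (uniform_sphere R) (spherical_cap R \<theta>cap c)
     = emeasure (uniform_sphere R) (UNIV - {x. \<theta>cap < central_angle x c})"
    unfolding spherical_cap_def by (intro emeasure_eq_AE) auto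
  also have "\<dots> = 1 - emeasure (uniform_sphere R) {x. \<theta>cap < central_angle x c}"
    using emeasure_compl[of "{x. \<theta>cap < central_angle x c}" "uniform_sphere R"] emeasure_space_1
    by (simp add: emeasure_uniform_sphere_angle_gt c R)
  also have "\<dots> = ennreal (1 - (1 + cos \<theta>cap) / 2)"
    using th one_plus_cos_nonneg[of \<theta>cap]
    by (simp add: emeasure_uniform_sphere_angle_gt c R ennreal_minus flip: ennreal_1)
  finally show ?thesis by (simp add: field_simps)
qed

lemma f_LU_nonneg: "0 \<le> \<theta> \<Longrightarrow> \<theta> \<le> pi \<Longrightarrow> 0 \<le> f_LU NL \<theta>"
  using one_plus_cos_nonneg[of \<theta>] by (simp add: f_LU_def sin_ge_zero)

lemma borel_measurable_f_LU [measurable]: "f_LU NL \<in> borel_measurable borel"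
  unfolding f_LU_def[abs_def] by measurable

text \<open>\<open>f_LU\<close> is the derivative of \<open>- ((1 + cos \<theta>) / 2) ^ NL\<close>,
  the negative of the probability that all leaders have an angle above
  \<open>\<theta>\<close>.\<close>

lemma nn_integral_f_LU:
  fixes a :: real
  defines "a' \<equiv> max 0 (min a pi)"
  assumes "NL \<ge> 1"
  shows "(\<integral>\<^sup>+\<theta>. ennreal (f_LU NL \<theta> * indicator {0..pi} \<theta> * indicator {..a} \<theta>) \<partial>lborel)
     = ennreal (1 - ((1 + cos a') / 2) ^ NL)"
proof -
  have a': "0 \<le> a'" "a' \<le> pi" by (auto simp: a'_def)
  have "(\<integral>\<^sup>+\<theta>. ennreal (f_LU NL \<theta> * indicator {0..pi} \<theta> * indicator {..a} \<theta>) \<partial>lborel)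
     = (\<integral>\<^sup>+\<theta>. ennreal (f_LU NL \<theta>) * indicator {0..a'} \<theta> \<partial>lborel)"
    \<comment> \<open>For negative \<open>a\<close> the clamped interval still contains the point 0,
      a null set.\<close>
    using AE_lborel_singleton[of 0] by (intro nn_integral_cong_AE, eventually_elim)
       (auto simp: a'_def split: split_indicator)
  also have "\<dots> = ennreal (- (((1 + cos a') / 2) ^ NL) - (- (((1 + cos 0) / 2) ^ NL)))"
    by (rule nn_integral_FTC_Icc)
       (use a' in \<open>auto simp: f_LU_def has_real_derivative_iff_has_vector_derivative[symmetric]
             intro!: derivative_eq_intros mult_nonneg_nonneg sin_ge_zero zero_le_power
                 one_plus_cos_nonneg\<close>)
  finally show ?thesis by simp
qed

context prob_space
begin

text \<open>On the sphere nearest means smallest central angle, so the angle of the nearest point exceeds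
  \<open>a\<close> iff all of them do.\<close>

lemma distributed_nearest_angle:
  fixes leader :: "nat \<Rightarrow> 'a \<Rightarrow> real^3"
  assumes NL: "NL \<ge> 1" and u: "u \<noteq> 0" and R: "0 < R"
    and indep: "indep_vars (\<lambda>_. borel) leader {1..NL}"
    and law: "\<And>j. j \<in> {1..NL} \<Longrightarrow> distr M borel (leader j) = uniform_sphere R"
  defines "assoc \<equiv> \<lambda>\<omega>. leader (nearest NL (\<lambda>j. leader j \<omega>) u) \<omega>"
  shows "distributed M lborel (\<lambda>\<omega>. central_angle (assoc \<omega>) u) (\<lambda>\<theta>. f_LU NL \<theta> * indicator {0..pi} \<theta>)"
    and "AE \<omega> in M. norm (assoc \<omega>) = R"
    and "assoc \<in> borel_measurable M"
proof -
  have rv [measurable]: "leader j \<in> borel_measurable M" if "j \<in> {1..NL}" for j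
    using indep that by (auto simp: indep_vars_def)
  have norms: "AE \<omega> in M. \<forall>j\<in>{1..NL}. norm (leader j \<omega>) = R"
  proof (rule AE_finite_allI)
    fix j assume j: "j \<in> {1..NL}"
    have "AE x in distr M borel (leader j). norm x = R"
      unfolding law[OF j] using R by (intro AE_uniform_sphere_norm) simp
    then show "AE \<omega> in M. norm (leader j \<omega>) = R"
      using rv[OF j] by (simp add: AE_distr_iff)
  qed simp
  have assoc_in: "nearest NL (\<lambda>j. leader j \<omega>) u \<in> {1..NL}" for \<omega>
    by (rule nearest_in_range[OF NL])
  show "AE \<omega> in M. norm (assoc \<omega>) = R"
    using norms assoc_in by (auto simp: assoc_def elim!: eventually_mono)
  \<comment> \<open>The nearest index looks at the components \<open>1..NL\<close> alone, so
    \<open>assoc\<close> factors through the restricted leader vector.\<close>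
  have "(\<lambda>\<omega>. \<lambda>j\<in>{1..NL}. leader j \<omega>) \<in> measurable M (PiM {1..NL} (\<lambda>_. borel))"
    by (intro measurable_restrict) simp
  from measurable_compose[OF this measurable_nearest_point[OF NL, of u]]
  show am [measurable]: "assoc \<in> borel_measurable M"
    using assoc_in nearest_cong[of NL "\<lambda>j\<in>{1..NL}. leader j \<omega>" "\<lambda>j. leader j \<omega>" u for \<omega>]
    by (simp add: assoc_def)
  have gt: "emeasure M {\<omega>\<in>space M. a < central_angle (assoc \<omega>) u} = ennreal (((1
      + cos (max 0 (min a pi))) / 2) ^ NL)"
    for a
  proof -
    have P: "prob (leader j -` {x. a < central_angle x u} \<inter> space M) = (1 + cos (max 0 (min a pi))) / 2"
      if j: "j \<in> {1..NL}" for j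
    proof -
      have "ennreal (prob (leader j -` {x. a < central_angle x u} \<inter> space M))
         = emeasure (distr M borel (leader j)) {x. a < central_angle x u}"
        using rv[OF j] by (simp add: emeasure_distr emeasure_eq_measure)
      also have "\<dots> = ennreal ((1 + cos (max 0 (min a pi))) / 2)"
        unfolding law[OF j] by (rule emeasure_uniform_sphere_angle_gt[OF u R])
      finally show ?thesis
        using one_plus_cos_nonneg[of "max 0 (min a pi)"] by (subst (asm) ennreal_inj) auto
    qed
    have "AE \<omega> in M. \<omega> \<in> {\<omega>\<in>space M. a < central_angle (assoc \<omega>) u} \<longleftrightarrow>
        \<omega> \<in> (\<Inter>j\<in>{1..NL}. leader j -` {x. a < central_angle x u} \<inter> space M)"
      using norms AE_space
    proof eventually_elim
      case (elim \<omega>)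
      have mono: "central_angle (leader i \<omega>) u \<le> central_angle (leader j \<omega>) u"
        if "i \<in> {1..NL}" "j \<in> {1..NL}" "dist (leader i \<omega>) u \<le> dist (leader j \<omega>) u" for i j
      proof -
        have "leader i \<omega> \<noteq> 0" "leader j \<omega> \<noteq> 0" using elim that R by fastforce+
        then have "r_LU (norm u) R (central_angle (leader i \<omega>) u)
            \<le> r_LU (norm u) R (central_angle (leader j \<omega>) u)"
          using that elim u by (simp add: dist_eq_r_LU)
        then have "cos (central_angle (leader j \<omega>) u) \<le> cos (central_angle (leader i \<omega>) u)"
          using R u by (simp add: r_LU_def)
        then show ?thesis
          using cos_mono_le_eq central_angle_bounds by blast
      qed
      show ?case
      proof -
        let ?j = "nearest NL (\<lambda>j. leader j \<omega>) u"
        have "central_angle (leader ?j \<omega>) u \<le> central_angle (leader k \<omega>) u" if "k \<in> {1..NL}" for k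
          using nearest_in_range(2)[OF NL that, of "\<lambda>j. leader j \<omega>" u] by (intro mono assoc_in that)
        then have "a < central_angle (assoc \<omega>) u \<longleftrightarrow> (\<forall>k\<in>{1..NL}. a < central_angle (leader k \<omega>) u)"
          unfolding assoc_def using assoc_in[of \<omega>] by (meson less_le_trans)
        then show ?thesis using elim NL by auto
      qed
    qed
    then have "emeasure M {\<omega>\<in>space M. a < central_angle (assoc \<omega>) u} =
        emeasure M (\<Inter>j\<in>{1..NL}. leader j -` {x. a < central_angle x u} \<inter> space M)"
      using NL by (intro emeasure_eq_AE) (auto intro!: sets.finite_INT measurable_sets[OF rv])
    also have "\<dots> = ennreal (\<Prod>j\<in>{1..NL}. prob (leader j -` {x. a < central_angle x u} \<inter> space M))"
      using NL indep by (subst emeasure_eq_measure, subst indep_varsD[where M' = "\<lambda>_. borel" and J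
          = "{1..NL}"]) auto
    also have "\<dots> = ennreal (\<Prod>j\<in>{1..NL}. (1 + cos (max 0 (min a pi))) / 2)"
      by (simp only: P cong: prod.cong)
    finally show ?thesis by simp
  qed
  show "distributed M lborel (\<lambda>\<omega>. central_angle (assoc \<omega>) u) (\<lambda>\<theta>. f_LU NL \<theta> * indicator {0..pi} \<theta>)"
  proof (rule distributedI_borel_atMost)
    show "(\<integral>\<^sup>+\<theta>. ennreal (f_LU NL \<theta> * indicator {0..pi} \<theta> * indicator {..a} \<theta>) \<partial>lborel)
       = ennreal (1 - ((1 + cos (max 0 (min a pi))) / 2) ^ NL)" for a
      by (rule nn_integral_f_LU[OF NL])
    show "emeasure M {\<omega>\<in>space M. central_angle (assoc \<omega>) u \<le> a} = ennreal (1 - ((1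
        + cos (max 0 (min a pi))) / 2) ^ NL)" for a
    proof -
      have "{\<omega>\<in>space M. central_angle (assoc \<omega>) u \<le> a}
          = space M - {\<omega>\<in>space M. a < central_angle (assoc \<omega>) u}"
        by auto
      then have "emeasure M {\<omega>\<in>space M. central_angle (assoc \<omega>) u \<le> a} = 1 - ennreal (((1
          + cos (max 0 (min a pi))) / 2) ^ NL)"
        by (simp add: emeasure_compl gt emeasure_space_1)
      then show ?thesis
        using one_plus_cos_nonneg[of "max 0 (min a pi)"] by (simp add: ennreal_minus flip: ennreal_1)
    qed
    show "(\<lambda>\<theta>. f_LU NL \<theta> * indicator {0..pi} \<theta>) \<in> borel_measurable borel"
      unfolding f_LU_def by measurable
    show "AE \<theta> in lborel. 0 \<le> f_LU NL \<theta> * indicator {0..pi} \<theta>"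
    proof (intro AE_I2)
      fix \<theta> :: real
      show "0 \<le> f_LU NL \<theta> * indicator {0..pi} \<theta>"
        by (simp add: f_LU_nonneg split: split_indicator)
    qed
  qed simp
qed

end

section \<open>The uniform law on a cap and the joint law of leader and follower\<close>

lemma sets_spherical_cap [measurable]: "spherical_cap R \<theta>cap c \<in> sets borel"
  unfolding spherical_cap_def by measurable

lemma sets_uniform_cap [simp]: "sets (uniform_cap R \<theta>cap c) = sets borel"
  by (simp add: uniform_cap_def)

context
  fixes R \<theta>cap :: real
  assumes R: "0 < R" and cap: "0 < \<theta>cap" "\<theta>cap \<le> pi"
begin

lemma cap_density_pos: "0 < (1 - cos \<theta>cap) / 2"
  using cos_monotone_0_pi[of 0 \<theta>cap] cap by simp

text \<open>The constant is the reciprocal of the cap mass. Against the fixed law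
  \<open>uniform_sphere R\<close> the centre \<open>c\<close> enters through an indicator, which is
  jointly measurable in centre and point.\<close>

lemma emeasure_uniform_cap:
  assumes "c \<noteq> 0" "A \<in> sets borel"
  shows "emeasure (uniform_cap R \<theta>cap c) A
    = (\<integral>\<^sup>+x. indicator (spherical_cap R \<theta>cap c) x * indicator A x
        * ennreal (2 / (1 - cos \<theta>cap)) \<partial>uniform_sphere R)"
proof -
  note [measurable] = assms(2)
  have "emeasure (uniform_cap R \<theta>cap c) A
    = emeasure (uniform_sphere R) (spherical_cap R \<theta>cap c \<inter> A) / ennreal ((1 - cos \<theta>cap) / 2)"
    unfolding uniform_cap_def
    by (subst emeasure_uniform_measure) (use assms cap R in \<open>simp_all add: emeasure_spherical_cap\<close>)
  also have "\<dots> = emeasure (uniform_sphere R) (spherical_cap R \<theta>cap c \<inter> A) * ennreal (2 / (1 - cos \<theta>cap))"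
    using cap_density_pos by (simp add: divide_ennreal_def inverse_ennreal)
  also have "emeasure (uniform_sphere R) (spherical_cap R \<theta>cap c \<inter> A)
    = (\<integral>\<^sup>+x. indicator (spherical_cap R \<theta>cap c) x * indicator A x \<partial>uniform_sphere R)"
    by (simp add: indicator_inter_arith[symmetric])
  finally show ?thesis
    by (simp add: nn_integral_multc)
qed

lemma prob_space_uniform_cap:
  assumes "c \<noteq> 0"
  shows "prob_space (uniform_cap R \<theta>cap c)"
  unfolding uniform_cap_def
  by (rule prob_space_uniform_measure)
     (use assms R cap cap_density_pos in \<open>simp_all add: emeasure_spherical_cap\<close>)

end

text \<open>The joint law \<open>?P\<close> of leader and follower is compared with the measure
  \<open>?Q\<close> of density \<open>d\<close> against the product of the leader law and the sphere
  law. Conditioning identifies the two on rectangles, for which one event at a time suffices;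
  rectangles are stable under intersection and generate the product, so the finite measures coincide
  and the formula extends to every nonnegative \<open>K\<close>.\<close>

lemma (in prob_space) nn_integral_cond_iid_cap:
  fixes F :: "'i \<Rightarrow> 'a \<Rightarrow> real^3" and \<alpha> :: "'b \<Rightarrow> real^3"
  assumes R: "0 < R" and cap: "0 < \<theta>cap" "\<theta>cap \<le> pi"
    and L [measurable]: "L \<in> measurable M N" and \<alpha> [measurable]: "\<alpha> \<in> borel_measurable N"
    and norm: "AE \<omega> in M. norm (\<alpha> (L \<omega>)) = R"
    and I: "finite I" "i \<in> I"
    and iid: "cond_iid M (vimage_algebra (space M) L N) I F (\<lambda>\<omega>. uniform_cap R \<theta>cap (\<alpha> (L \<omega>)))"
    and K [measurable]: "K \<in> borel_measurable (borel \<Otimes>\<^sub>M borel)"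
  shows "(\<integral>\<^sup>+\<omega>. K (\<alpha> (L \<omega>), F i \<omega>) \<partial>M) =
    (\<integral>\<^sup>+\<omega>. (\<integral>\<^sup>+x. indicator (spherical_cap R \<theta>cap (\<alpha> (L \<omega>))) x * ennreal (2 / (1 - cos \<theta>cap)) *
       K (\<alpha> (L \<omega>), x) \<partial>uniform_sphere R) \<partial>M)"
proof -
  let ?G = "vimage_algebra (space M) L N" and ?\<mu> = "uniform_sphere R"
  define d :: "(real^3) \<times> (real^3) \<Rightarrow> ennreal"
    where "d p = indicator (spherical_cap R \<theta>cap (fst p)) (snd p) * ennreal (2 / (1 - cos \<theta>cap))" for p
  have d [measurable]: "d \<in> borel_measurable (borel \<Otimes>\<^sub>M borel)"
    unfolding d_def spherical_cap_def indicator_def by measurable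
  interpret S: prob_space ?\<mu> by (rule prob_space_uniform_sphere)
  have F [measurable]: "F i \<in> borel_measurable M"
    using iid I by (simp add: cond_iid_def)
  have subalg: "subalgebra M ?G"
    using L by (auto simp: subalgebra_def sets_vimage_algebra2 measurable_def)
  interpret sub: finite_measure_subalgebra M ?G
    by unfold_locales (rule subalg)
  have nz: "AE \<omega> in M. \<alpha> (L \<omega>) \<noteq> 0"
    using norm R by (auto elim!: eventually_mono)
  let ?P = "distr M (borel \<Otimes>\<^sub>M borel) (\<lambda>\<omega>. (\<alpha> (L \<omega>), F i \<omega>))"
  let ?Q = "density (distr M borel (\<lambda>\<omega>. \<alpha> (L \<omega>)) \<Otimes>\<^sub>M ?\<mu>) d"
  have nnQ: "(\<integral>\<^sup>+p. k p \<partial>?Q) = (\<integral>\<^sup>+\<omega>. (\<integral>\<^sup>+x. d (\<alpha> (L \<omega>), x) * k (\<alpha> (L \<omega>), x) \<partial>?\<mu>) \<partial>M)"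
    if [measurable]: "k \<in> borel_measurable (borel \<Otimes>\<^sub>M borel)" for k
  proof -
    have "(\<integral>\<^sup>+p. k p \<partial>?Q) = (\<integral>\<^sup>+p. d p * k p \<partial>(distr M borel (\<lambda>\<omega>. \<alpha> (L \<omega>)) \<Otimes>\<^sub>M ?\<mu>))"
      by (rule nn_integral_density) measurable
    also have "\<dots> = (\<integral>\<^sup>+c. (\<integral>\<^sup>+x. d (c, x) * k (c, x) \<partial>?\<mu>) \<partial>distr M borel (\<lambda>\<omega>. \<alpha> (L \<omega>)))"
      by (rule S.nn_integral_fst[symmetric]) measurable
    also have "\<dots> = (\<integral>\<^sup>+\<omega>. (\<integral>\<^sup>+x. d (\<alpha> (L \<omega>), x) * k (\<alpha> (L \<omega>), x) \<partial>?\<mu>) \<partial>M)"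
      by (rule nn_integral_distr) measurable
    finally show ?thesis .
  qed
  have rect: "emeasure ?P (A \<times> B) = emeasure ?Q (A \<times> B)"
    if [measurable]: "A \<in> sets borel" "B \<in> sets borel" for A B
  proof -
    let ?D = "{\<omega>\<in>space M. \<alpha> (L \<omega>) \<in> A}" and ?f = "indicator {\<omega>\<in>space M. F i \<omega> \<in> B} :: 'a \<Rightarrow> real"
    have "?D = L -` (\<alpha> -` A \<inter> space N) \<inter> space M"
      using measurable_space[OF L] by auto
    moreover have "\<alpha> -` A \<inter> space N \<in> sets N" by measurable
    ultimately have D: "?D \<in> sets ?G"
      by (simp only: in_vimage_algebra)
    have Dm [measurable]: "?D \<in> sets M" by measurable
    have f: "integrable M ?f"
      by (rule integrable_real_indicator) (auto simp: less_top[symmetric])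
    \<comment> \<open>The event constrains follower \<open>i\<close>; the sets \<open>UNIV\<close>
      for the others contribute factors 1, because almost surely the centre is nonzero and the cap
      law is a probability measure.\<close>
    have "{\<omega>\<in>space M. \<forall>j\<in>I. F j \<omega> \<in> (if j = i then B else UNIV)} = {\<omega>\<in>space M. F i \<omega> \<in> B}"
      using I by auto
    then have "AE \<omega> in M. real_cond_exp M ?G ?f \<omega>
        = (\<Prod>j\<in>I. measure (uniform_cap R \<theta>cap (\<alpha> (L \<omega>))) (if j = i then B else UNIV))"
      using iid[unfolded cond_iid_def, THEN conjunct2, rule_format, of "\<lambda>j. if j
          = i then B else UNIV"] that
      by simp
    then have ce: "AE \<omega> in M. ennreal (real_cond_exp M ?G ?f \<omega>) = (\<integral>\<^sup>+x. d (\<alpha> (L \<omega>), x)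
        * indicator B x \<partial>?\<mu>)
        \<and> 0 \<le> real_cond_exp M ?G ?f \<omega>"
      using nz
    proof eventually_elim
      case (elim \<omega>)
      interpret U: prob_space "uniform_cap R \<theta>cap (\<alpha> (L \<omega>))"
        using elim(2) by (rule prob_space_uniform_cap[OF R cap])
      have "space (uniform_cap R \<theta>cap (\<alpha> (L \<omega>))) = UNIV"
        by (simp add: uniform_cap_def)
      then have "measure (uniform_cap R \<theta>cap (\<alpha> (L \<omega>))) UNIV = 1"
        using U.prob_space by simp
      then have "(\<Prod>j\<in>I. measure (uniform_cap R \<theta>cap (\<alpha> (L \<omega>))) (if j = i then B else UNIV))
         = (\<Prod>j\<in>I. if j = i then measure (uniform_cap R \<theta>cap (\<alpha> (L \<omega>))) B else 1)"
        by (intro prod.cong) auto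
      also have "\<dots> = measure (uniform_cap R \<theta>cap (\<alpha> (L \<omega>))) B"
        using I by simp
      finally have "ennreal (real_cond_exp M ?G ?f \<omega>) = emeasure (uniform_cap R \<theta>cap (\<alpha> (L \<omega>))) B"
        using elim(1) by (simp add: U.emeasure_eq_measure)
      then show ?case
        using elim by (simp add: emeasure_uniform_cap[OF R cap] d_def mult_ac prod_nonneg)
    qed
    have "emeasure ?P (A \<times> B) = emeasure M (?D \<inter> {\<omega>\<in>space M. F i \<omega> \<in> B})"
      by (subst emeasure_distr) (auto intro!: arg_cong2[where f = emeasure])
    also have "\<dots> = ennreal (\<integral>\<omega>. indicator ?D \<omega> * ?f \<omega> \<partial>M)"
      by (simp add: emeasure_eq_measure indicator_inter_arith[symmetric])
    \<comment> \<open>The defining property of conditional expectation, on an event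
      \<open>?D\<close> of the conditioning sigma-algebra.\<close>
    also have "(\<integral>\<omega>. indicator ?D \<omega> * ?f \<omega> \<partial>M) = (\<integral>\<omega>. indicator ?D \<omega> * real_cond_exp M ?G ?f \<omega> \<partial>M)"
      using sub.real_cond_exp_intA[OF f D] by (simp add: set_lebesgue_integral_def)
    also have "ennreal \<dots> = (\<integral>\<^sup>+\<omega>. ennreal (indicator ?D \<omega> * real_cond_exp M ?G ?f \<omega>) \<partial>M)"
    proof (rule nn_integral_eq_integral[symmetric])
      have "integrable M (real_cond_exp M ?G ?f)"
        by (rule sub.real_cond_exp_int[OF f])
      from integrable_mult_indicator[OF Dm this]
      show "integrable M (\<lambda>\<omega>. indicator ?D \<omega> * real_cond_exp M ?G ?f \<omega>)" by simp
      show "AE \<omega> in M. 0 \<le> indicator ?D \<omega> * real_cond_exp M ?G ?f \<omega>"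
        using ce by eventually_elim simp
    qed
    also have "\<dots> = (\<integral>\<^sup>+\<omega>. (\<integral>\<^sup>+x. d (\<alpha> (L \<omega>), x) * indicator (A \<times> B) (\<alpha> (L \<omega>), x) \<partial>?\<mu>) \<partial>M)"
      using ce AE_space
      by (intro nn_integral_cong_AE, eventually_elim) (auto simp: indicator_times split: split_indicator)
    also have "\<dots> = emeasure ?Q (A \<times> B)"
      by (subst nnQ[symmetric]) auto
    finally show ?thesis .
  qed
  have "?P = ?Q"
  proof (rule measure_eqI_generator_eq[OF Int_stable_pair_measure_generator[of borel borel]])
    show "{a \<times> b |a b. a \<in> sets borel
        \<and> b \<in> sets borel} \<subseteq> Pow (UNIV \<times> UNIV :: ((real^3) \<times> (real^3)) set)" by simp
    show "emeasure ?P X = emeasure ?Q X" if "X \<in> {a \<times> b |a b. a \<in> sets borel \<and> b \<in> sets borel}" for X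
      using that rect by auto
    show "range (\<lambda>_ :: nat. UNIV \<times> UNIV) \<subseteq> {a \<times> b |a b. a \<in> sets borel
        \<and> b \<in> sets (borel :: (real^3) measure)}"
      by (auto intro!: exI[of _ UNIV])
    have "sets (borel \<Otimes>\<^sub>M borel)
        = sigma_sets (UNIV \<times> UNIV) {a \<times> b |a b. a \<in> sets (borel :: (real^3) measure)
        \<and> b \<in> sets (borel :: (real^3) measure)}"
      using sets_pair_measure[of "borel :: (real^3) measure" "borel :: (real^3) measure"] by simp
    moreover have "sets ?Q = sets (borel \<Otimes>\<^sub>M borel)"
      by (simp cong: sets_pair_measure_cong)
    ultimately show "sets ?P = sigma_sets (UNIV \<times> UNIV) {a \<times> b |a b. a \<in> sets borel \<and> b \<in> sets borel}"
      "sets ?Q = sigma_sets (UNIV \<times> UNIV) {a \<times> b |a b. a \<in> sets borel \<and> b \<in> sets borel}"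
      by simp_all
    show "emeasure ?P (UNIV \<times> UNIV) \<noteq> \<infinity>"
      using finite_measure.emeasure_finite[OF finite_measure_distr[of "\<lambda>\<omega>. (\<alpha> (L \<omega>), F i \<omega>)"
          "borel \<Otimes>\<^sub>M borel"]] by simp
  qed auto
  have "(\<integral>\<^sup>+\<omega>. K (\<alpha> (L \<omega>), F i \<omega>) \<partial>M) = (\<integral>\<^sup>+p. K p \<partial>?P)"
    by (rule nn_integral_distr[symmetric]) measurable
  also have "\<dots> = (\<integral>\<^sup>+p. K p \<partial>?Q)"
    by (simp only: \<open>?P = ?Q\<close>)
  also note nnQ[OF K]
  finally show ?thesis
    by (simp add: d_def)
qed

text \<open>The product rule for events makes the joint law of \<open>X\<close> and \<open>Y\<close>
  a product measure. It is assumed in this raw form so that independence of two sigma-algebras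
  supplies it directly.\<close>

lemma (in prob_space) nn_integral_indep_density:
  fixes X :: "'a \<Rightarrow> real"
  assumes X: "distributed M lborel X (\<lambda>w. ennreal (f w))"
    and Y [measurable]: "Y \<in> measurable M N"
    and indep: "\<And>A B. A \<in> sets borel \<Longrightarrow> B \<in> sets N \<Longrightarrow>
      prob ((X -` A \<inter> space M) \<inter> (Y -` B \<inter> space M)) = prob (X -` A \<inter> space M) * prob (Y -` B \<inter> space M)"
    and K [measurable]: "case_prod K \<in> borel_measurable (borel \<Otimes>\<^sub>M N)"
  shows "(\<integral>\<^sup>+\<omega>. K (X \<omega>) (Y \<omega>) \<partial>M) = (\<integral>\<^sup>+w. ennreal (f w) * (\<integral>\<^sup>+\<omega>. K w (Y \<omega>) \<partial>M) \<partial>lborel)"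
proof -
  have Xm [measurable]: "X \<in> borel_measurable M"
    using distributed_measurable[OF X] by simp
  have fm [measurable]: "(\<lambda>w. ennreal (f w)) \<in> borel_measurable borel"
    using distributed_borel_measurable[OF X] by simp
  interpret PX: prob_space "distr M borel X" by (rule prob_space_distr) simp
  interpret PY: prob_space "distr M N Y" by (rule prob_space_distr) simp
  have "distr M borel X \<Otimes>\<^sub>M distr M N Y = distr M (borel \<Otimes>\<^sub>M N) (\<lambda>\<omega>. (X \<omega>, Y \<omega>))"
  proof (rule pair_measure_eqI)
    fix A B assume "A \<in> sets (distr M borel X)" "B \<in> sets (distr M N Y)"
    then have [measurable]: "A \<in> sets borel" "B \<in> sets N" by auto
    have "(\<lambda>\<omega>. (X \<omega>, Y \<omega>)) -` (A \<times> B) \<inter> space M = (X -` A \<inter> space M) \<inter> (Y -` B \<inter> space M)"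
      by auto
    then show "emeasure (distr M borel X) A * emeasure (distr M N Y) B =
        emeasure (distr M (borel \<Otimes>\<^sub>M N) (\<lambda>\<omega>. (X \<omega>, Y \<omega>))) (A \<times> B)"
      by (simp add: emeasure_distr emeasure_eq_measure indep ennreal_mult)
  qed (auto simp: PX.sigma_finite_measure_axioms PY.sigma_finite_measure_axioms cong:
      sets_pair_measure_cong)
  note eq = this
  have "(\<integral>\<^sup>+\<omega>. K (X \<omega>) (Y \<omega>) \<partial>M) = (\<integral>\<^sup>+p. case_prod K p \<partial>distr M (borel \<Otimes>\<^sub>M N) (\<lambda>\<omega>. (X \<omega>, Y \<omega>)))"
    by (subst nn_integral_distr) auto
  also have "\<dots> = (\<integral>\<^sup>+w. (\<integral>\<^sup>+y. K w y \<partial>distr M N Y) \<partial>distr M borel X)"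
    unfolding eq[symmetric] by (subst PY.nn_integral_fst[symmetric]) auto
  also have "\<dots> = (\<integral>\<^sup>+w. (\<integral>\<^sup>+\<omega>. K w (Y \<omega>) \<partial>M) \<partial>distr M borel X)"
    by (intro nn_integral_cong nn_integral_distr) auto
  also have "\<dots> = (\<integral>\<^sup>+\<omega>. (\<lambda>w. \<integral>\<^sup>+\<omega>'. K w (Y \<omega>') \<partial>M) (X \<omega>) \<partial>M)"
    by (rule nn_integral_distr) measurable
  also have "\<dots> = (\<integral>\<^sup>+w. ennreal (f w) * (\<integral>\<^sup>+\<omega>. K w (Y \<omega>) \<partial>M) \<partial>lborel)"
    by (rule distributed_nn_integral[OF X, symmetric]) measurable
  finally show ?thesis .
qed

section \<open>Integrals over the positions of the associated leader and of one follower\<close>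

lemma measurable_compose_3:
  assumes "case_prod (case_prod k) \<in> borel_measurable ((borel \<Otimes>\<^sub>M borel) \<Otimes>\<^sub>M borel)"
    and "f \<in> borel_measurable N" "g \<in> borel_measurable N" "h \<in> borel_measurable N"
  shows "(\<lambda>x. k (f x) (g x) (h x)) \<in> borel_measurable N"
proof -
  have "(\<lambda>x. ((f x, g x), h x)) \<in> measurable N ((borel \<Otimes>\<^sub>M borel) \<Otimes>\<^sub>M borel)"
    using assms(2-4) by (intro measurable_Pair)
  from measurable_compose[OF this assms(1)] show ?thesis by simp
qed

lemma borel_measurable_r_LU [measurable]: "r_LU r R \<in> borel_measurable borel"
  unfolding r_LU_def[abs_def] by measurable

lemma borel_measurable_r_LF [measurable]: "r_LF R \<in> borel_measurable borel"
  unfolding r_LF_def[abs_def] by measurable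

lemma borel_measurable_r_FU [measurable]:
  assumes [measurable]: "f \<in> borel_measurable N" "g \<in> borel_measurable N" "h \<in> borel_measurable N"
  shows "(\<lambda>x. r_FU r R (f x) (g x) (h x)) \<in> borel_measurable N"
  unfolding r_FU_def by measurable

text \<open>\<open>assoc\<close> and \<open>leaders\<close> are parameters pinned down by equations,
  so that the objects of the final statement can be inserted as they are. The radii enter through a
  user off the centre and strictly inside the satellite sphere.\<close>

locale satellite_cluster = prob_space M for M :: "'a measure" +
  fixes R \<theta>cap :: real and NL NF :: nat and user :: "real^3"
    and leader follower :: "nat \<Rightarrow> 'a \<Rightarrow> real^3" and assoc :: "'a \<Rightarrow> real^3"
    and leaders :: "'a \<Rightarrow> nat \<Rightarrow> real^3"
  assumes user: "user \<noteq> 0" "norm user < R"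
    and NL: "NL \<ge> 1"
    and cap: "0 < \<theta>cap" "\<theta>cap \<le> pi"
    and indep: "indep_vars (\<lambda>_. borel) leader {1..NL}"
    and law: "\<And>j. j \<in> {1..NL} \<Longrightarrow> distr M borel (leader j) = uniform_sphere R"
    and leaders_def: "leaders = (\<lambda>\<omega>. \<lambda>j\<in>{1..NL}. leader j \<omega>)"
    and assoc_def: "assoc = (\<lambda>\<omega>. leader (nearest NL (\<lambda>j. leader j \<omega>) user) \<omega>)"
    and iid: "cond_iid M (vimage_algebra (space M) leaders (PiM {1..NL} (\<lambda>_. borel))) {1..NF} follower
             (\<lambda>\<omega>. uniform_cap R \<theta>cap (assoc \<omega>))"
begin

lemma R: "0 < R" using user by (meson le_less_trans norm_ge_zero)

abbreviation "\<Theta> \<omega> \<equiv> central_angle (assoc \<omega>) user"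

lemma distributed_angle: "distributed M lborel \<Theta> (\<lambda>\<theta>. f_LU NL \<theta> * indicator {0..pi} \<theta>)"
  and AE_norm_assoc: "AE \<omega> in M. norm (assoc \<omega>) = R"
  and borel_measurable_assoc [measurable]: "assoc \<in> borel_measurable M"
  unfolding assoc_def
  using distributed_nearest_angle[OF NL user(1) R indep law] by simp_all

lemma measurable_leaders [measurable]: "leaders \<in> measurable M (PiM {1..NL} (\<lambda>_. borel))"
  using indep unfolding leaders_def by (intro measurable_restrict) (auto simp: indep_vars_def)

text \<open>Exhibits the associated leader as a function of the leader vector that generates the
  conditioning sigma-algebra; this function is the \<open>\<alpha>\<close> of
  \<open>nn_integral_cond_iid_cap\<close>.\<close>

lemma assoc_eq: "assoc \<omega> = (\<lambda>x. x (nearest NL x user)) (leaders \<omega>)"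
proof -
  have "nearest NL (leaders \<omega>) user = nearest NL (\<lambda>j. leader j \<omega>) user"
    by (rule nearest_cong) (simp add: leaders_def)
  moreover have "nearest NL (\<lambda>j. leader j \<omega>) user \<in> {1..NL}"
    by (rule nearest_in_range[OF NL])
  ultimately show ?thesis by (simp add: assoc_def leaders_def)
qed

lemma borel_measurable_follower [measurable]: "i \<in> {1..NF} \<Longrightarrow> follower i \<in> borel_measurable M"
  using iid by (simp add: cond_iid_def)

lemma nn_integral_assoc_follower:
  assumes i: "i \<in> {1..NF}" and K: "K \<in> borel_measurable (borel \<Otimes>\<^sub>M borel)"
  shows "(\<integral>\<^sup>+\<omega>. K (assoc \<omega>, follower i \<omega>) \<partial>M) =
    (\<integral>\<^sup>+\<omega>. (\<integral>\<^sup>+x. indicator (spherical_cap R \<theta>cap (assoc \<omega>)) x * ennreal (2 / (1 - cos \<theta>cap)) *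
       K (assoc \<omega>, x) \<partial>uniform_sphere R) \<partial>M)"
proof -
  have "AE \<omega> in M. norm ((\<lambda>x. x (nearest NL x user)) (leaders \<omega>)) = R"
    using AE_norm_assoc by (simp add: assoc_eq)
  then show ?thesis
    unfolding assoc_eq using iid[unfolded assoc_eq[abs_def]]
    by (intro nn_integral_cond_iid_cap[where N = "PiM {1..NL} (\<lambda>_. borel)" and I = "{1..NF}"
          and \<alpha> = "\<lambda>x. x (nearest NL x user)"]
              R cap measurable_leaders measurable_nearest_point NL i K) auto
qed

text \<open>The follower formula is applied to the indicator of a wrong norm, which vanishes on the
  cap. The result keeps followers away from the user and so bounds their rates.\<close>

lemma AE_norm_follower:
  assumes i: "i \<in> {1..NF}"
  shows "AE \<omega> in M. norm (follower i \<omega>) = R"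
proof -
  have "(\<integral>\<^sup>+\<omega>. indicator {p. norm (snd p) \<noteq> R} (assoc \<omega>, follower i \<omega>) \<partial>M) = 0"
    by (subst nn_integral_assoc_follower[OF i])
       (auto simp: spherical_cap_def intro!: nn_integral_zero' AE_I2 split: split_indicator)
  moreover have "(\<lambda>\<omega>. indicator {p. norm (snd p) \<noteq> R} (assoc \<omega>, follower i \<omega>) :: ennreal)
      \<in> borel_measurable M"
    using i by measurable
  ultimately have "AE \<omega> in M. (indicator {p. norm (snd p) \<noteq> R} (assoc \<omega>, follower i \<omega>) :: ennreal) = 0"
    by (simp add: nn_integral_0_iff_AE)
  then show ?thesis by (auto simp: indicator_def elim!: eventually_mono split: if_splits)
qed

lemma nn_integral_angle:
  assumes [measurable]: "case_prod k \<in> borel_measurable (borel \<Otimes>\<^sub>M borel)"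
  shows "(\<integral>\<^sup>+\<omega>. k (\<Theta> \<omega>) (dist (assoc \<omega>) user) \<partial>M) =
    (\<integral>\<^sup>+\<theta>. ennreal (f_LU NL \<theta>) * indicator {0..pi} \<theta> * k \<theta> (r_LU (norm user) R \<theta>) \<partial>lborel)"
proof -
  have "(\<integral>\<^sup>+\<omega>. k (\<Theta> \<omega>) (dist (assoc \<omega>) user) \<partial>M) = (\<integral>\<^sup>+\<omega>. k (\<Theta> \<omega>) (r_LU (norm user) R (\<Theta> \<omega>)) \<partial>M)"
    using AE_norm_assoc
  proof (intro nn_integral_cong_AE, eventually_elim)
    case (elim \<omega>)
    then have "assoc \<omega> \<noteq> 0" using R by auto
    then show ?case using dist_eq_r_LU[of "assoc \<omega>" user] elim user by simp
  qed
  also have "\<dots> = (\<integral>\<^sup>+\<theta>. ennreal (f_LU NL \<theta> * indicator {0..pi} \<theta>) * k \<theta> (r_LU (norm user) R \<theta>) \<partial>lborel)"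
    by (rule distributed_nn_integral[OF distributed_angle, symmetric]) measurable
  also have "\<dots> = (\<integral>\<^sup>+\<theta>. ennreal (f_LU NL \<theta>) * indicator {0..pi} \<theta> * k \<theta> (r_LU (norm user) R \<theta>) \<partial>lborel)"
    by (intro nn_integral_cong) (auto split: split_indicator)
  finally show ?thesis .
qed

lemma nn_integral_follower:
  assumes i: "i \<in> {1..NF}"
    and k: "case_prod (case_prod k) \<in> borel_measurable ((borel \<Otimes>\<^sub>M borel) \<Otimes>\<^sub>M borel)"
  shows "(\<integral>\<^sup>+\<omega>. k (\<Theta> \<omega>) (dist (assoc \<omega>) (follower i \<omega>)) (dist (follower i \<omega>) user) \<partial>M) =
    (\<integral>\<^sup>+\<theta>. \<integral>\<^sup>+\<psi>. \<integral>\<^sup>+\<phi>. ennreal (f_LU NL \<theta>) * indicator {0..pi} \<theta> *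
       (ennreal (sin \<psi> / (2 * pi * (1 - cos \<theta>cap))) * indicator {0..\<theta>cap} \<psi> * indicator {0..2*pi} \<phi> *
        k \<theta> (r_LF R \<psi>) (r_FU (norm user) R \<theta> \<psi> \<phi>)) \<partial>lborel \<partial>lborel \<partial>lborel)"
proof -
  note [measurable] = measurable_compose_3[OF k]
  let ?C = "2 / (1 - cos \<theta>cap)"
  have C: "0 < 1 - cos \<theta>cap" using cap_density_pos[OF R cap] by simp
  let ?H = "\<lambda>\<theta>. \<integral>\<^sup>+\<psi>. \<integral>\<^sup>+\<phi>. ennreal (sin \<psi> / (2 * pi * (1 - cos \<theta>cap))) * indicator {0..\<theta>cap} \<psi>
      * indicator {0..2*pi} \<phi> *
        k \<theta> (r_LF R \<psi>) (r_FU (norm user) R \<theta> \<psi> \<phi>) \<partial>lborel \<partial>lborel"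
  have "(\<integral>\<^sup>+\<omega>. k (\<Theta> \<omega>) (dist (assoc \<omega>) (follower i \<omega>)) (dist (follower i \<omega>) user) \<partial>M) =
    (\<integral>\<^sup>+\<omega>. (\<lambda>p. k (central_angle (fst p) user) (dist (fst p) (snd p)) (dist (snd p) user)) (assoc \<omega>,
        follower i \<omega>) \<partial>M)"
    by simp
  also have "\<dots> = (\<integral>\<^sup>+\<omega>. (\<integral>\<^sup>+x. indicator (spherical_cap R \<theta>cap (assoc \<omega>)) x * ennreal ?C *
       k (\<Theta> \<omega>) (dist (assoc \<omega>) x) (dist x user) \<partial>uniform_sphere R) \<partial>M)"
    by (subst nn_integral_assoc_follower[OF i]) auto
  also have "\<dots> = (\<integral>\<^sup>+\<omega>. ?H (\<Theta> \<omega>) \<partial>M)"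
    using AE_norm_assoc
  proof (intro nn_integral_cong_AE, eventually_elim)
    case (elim \<omega>)
    have "(\<integral>\<^sup>+x. indicator (spherical_cap R \<theta>cap (assoc \<omega>)) x * ennreal ?C
        * k (\<Theta> \<omega>) (dist (assoc \<omega>) x) (dist x user) \<partial>uniform_sphere R)
      = (\<integral>\<^sup>+x. (\<lambda>a b c. indicator {..\<theta>cap} a * ennreal ?C
          * k (\<Theta> \<omega>) b c) (central_angle (assoc \<omega>) x) (dist (assoc \<omega>) x) (dist x user) \<partial>uniform_sphere R)"
      using AE_uniform_sphere_norm[of R] R
      by (intro nn_integral_cong_AE)
          (auto simp: spherical_cap_def elim!: eventually_mono split: split_indicator)
    also have "\<dots> = (\<integral>\<^sup>+\<psi>. \<integral>\<^sup>+\<phi>. ennreal (sin \<psi> / (4 * pi)) * indicator {0..pi} \<psi>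
        * indicator {0..2*pi} \<phi> *
        (indicator {..\<theta>cap} \<psi> * ennreal ?C
            * k (\<Theta> \<omega>) (r_LF R \<psi>) (r_FU (norm user) R (\<Theta> \<omega>) \<psi> \<phi>)) \<partial>lborel \<partial>lborel)"
      by (rule nn_integral_uniform_sphere_frame[OF _ elim(2) user(1) R]) (simp add: case_prod_unfold)
    also have "\<dots> = ?H (\<Theta> \<omega>)"
    proof (intro nn_integral_cong)
      fix \<psi> \<phi> :: real
      \<comment> \<open>The factor \<open>1 / (4 * pi)\<close> of the sphere law meets the cap
        constant \<open>2 / (1 - cos \<theta>cap)\<close>.\<close>
      have 1: "ennreal (sin \<psi> / (4 * pi)) * ennreal ?C = ennreal (sin \<psi> / (2 * pi * (1 - cos \<theta>cap)))"
      proof -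
        have "sin \<psi> / (4 * pi) * ?C = sin \<psi> / (2 * pi * (1 - cos \<theta>cap))"
          by (simp add: mult.assoc)
        then show ?thesis using C by (subst ennreal_mult''[symmetric]) auto
      qed
      have 2: "indicator {0..pi} \<psi> * indicator {..\<theta>cap} \<psi> = (indicator {0..\<theta>cap} \<psi> :: ennreal)"
        using cap by (auto split: split_indicator)
      show "ennreal (sin \<psi> / (4 * pi)) * indicator {0..pi} \<psi> * indicator {0..2*pi} \<phi> *
        (indicator {..\<theta>cap} \<psi> * ennreal ?C * k (\<Theta> \<omega>) (r_LF R \<psi>) (r_FU (norm user) R (\<Theta> \<omega>) \<psi> \<phi>))
        = ennreal (sin \<psi> / (2 * pi * (1 - cos \<theta>cap))) * indicator {0..\<theta>cap} \<psi> * indicator {0..2*pi} \<phi> *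
        k (\<Theta> \<omega>) (r_LF R \<psi>) (r_FU (norm user) R (\<Theta> \<omega>) \<psi> \<phi>)"
        unfolding 1[symmetric] 2[symmetric] by (simp only: mult_ac)
    qed
    finally show ?case .
  qed
  also have "\<dots> = (\<integral>\<^sup>+\<theta>. ennreal (f_LU NL \<theta>) * indicator {0..pi} \<theta> * ?H \<theta> \<partial>lborel)"
    by (rule nn_integral_angle[where k = "\<lambda>\<theta> _. ?H \<theta>"]) measurable
  also have "\<dots> = (\<integral>\<^sup>+\<theta>. \<integral>\<^sup>+\<psi>. \<integral>\<^sup>+\<phi>. ennreal (f_LU NL \<theta>) * indicator {0..pi} \<theta> *
       (ennreal (sin \<psi> / (2 * pi * (1 - cos \<theta>cap))) * indicator {0..\<theta>cap} \<psi> * indicator {0..2*pi} \<phi> *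
        k \<theta> (r_LF R \<psi>) (r_FU (norm user) R \<theta> \<psi> \<phi>)) \<partial>lborel \<partial>lborel \<partial>lborel)"
    by (intro nn_integral_cong, subst nn_integral_cmult[symmetric], measurable, intro nn_integral_cong,
        rule nn_integral_cmult[symmetric], measurable)
  finally show ?thesis .
qed

end

section \<open>Average rates\<close>

text \<open>For the outer layers of a nested integral: where the inner extended integral
  \<open>h\<close> is infinite, \<open>f\<close> may be anything, and finiteness of the total makes
  those points of \<open>A\<close> a null set.\<close>

lemma set_lebesgue_integral_eq_enn2real:
  assumes h [measurable]: "h \<in> borel_measurable lborel" and f [measurable]: "f \<in> borel_measurable lborel"
    and A [measurable]: "A \<in> sets lborel"
    and eq: "\<And>x. x \<in> A \<Longrightarrow> h x < \<infinity> \<Longrightarrow> f x = enn2real (h x)"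
    and fin: "(\<integral>\<^sup>+x. h x * indicator A x \<partial>lborel) < \<infinity>"
  shows "(LBINT x:A. f x) = enn2real (\<integral>\<^sup>+x. h x * indicator A x \<partial>lborel)"
proof -
  have AE: "AE x in lborel. h x * indicator A x \<noteq> \<infinity>"
    using fin by (intro nn_integral_noteq_infinite) auto
  have "(LBINT x:A. f x) = (\<integral>x. enn2real (h x * indicator A x) \<partial>lborel)"
    unfolding set_lebesgue_integral_def using AE
    by (intro integral_cong_AE) (auto simp: less_top eq split: split_indicator elim!: eventually_mono)
  also have "\<dots> = enn2real (\<integral>\<^sup>+x. ennreal (enn2real (h x * indicator A x)) \<partial>lborel)"
    by (rule integral_eq_nn_integral) auto
  also have "(\<integral>\<^sup>+x. ennreal (enn2real (h x * indicator A x)) \<partial>lborel) = (\<integral>\<^sup>+x. h x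
      * indicator A x \<partial>lborel)"
    using AE by (intro nn_integral_cong_AE) (auto simp: less_top elim!: eventually_mono)
  finally show ?thesis .
qed

text \<open>For the innermost layer, without a finiteness condition: if the extended integral is
  infinite, the Bochner integral is 0 by convention, and so is \<open>enn2real\<close> of
  infinity.\<close>

lemma set_lebesgue_integral_eq_nn_integral:
  assumes f [measurable]: "f \<in> borel_measurable lborel" and A [measurable]: "A \<in> sets lborel"
    and nonneg: "\<And>x. x \<in> A \<Longrightarrow> 0 \<le> f x"
  shows "(LBINT x:A. f x) = enn2real (\<integral>\<^sup>+x. ennreal (f x) * indicator A x \<partial>lborel)"
proof -
  have "(LBINT x:A. f x) = enn2real (\<integral>\<^sup>+x. ennreal (indicator A x *\<^sub>R f x) \<partial>lborel)"
    unfolding set_lebesgue_integral_def using nonneg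
    by (intro integral_eq_nn_integral) (auto split: split_indicator)
  also have "(\<integral>\<^sup>+x. ennreal (indicator A x *\<^sub>R f x) \<partial>lborel) = (\<integral>\<^sup>+x. ennreal (f x)
      * indicator A x \<partial>lborel)"
    by (intro nn_integral_cong) (auto split: split_indicator)
  finally show ?thesis .
qed

text \<open>Three adjacent exchanges. The angles arise in the order leader angle, polar angle,
  azimuth, and the closed form integrates them in the reverse order.\<close>

lemma nn_integral_rotate_3:
  fixes f :: "real \<Rightarrow> real \<Rightarrow> real \<Rightarrow> ennreal"
  assumes f: "case_prod (case_prod f) \<in> borel_measurable ((borel \<Otimes>\<^sub>M borel) \<Otimes>\<^sub>M borel)"
  shows "(\<integral>\<^sup>+x. \<integral>\<^sup>+y. \<integral>\<^sup>+z. f x y z \<partial>lborel \<partial>lborel \<partial>lborel)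
      = (\<integral>\<^sup>+z. \<integral>\<^sup>+y. \<integral>\<^sup>+x. f x y z \<partial>lborel \<partial>lborel \<partial>lborel)"
proof -
  note [measurable] = measurable_compose_3[OF f]
  have "(\<integral>\<^sup>+x. \<integral>\<^sup>+y. \<integral>\<^sup>+z. f x y z \<partial>lborel \<partial>lborel \<partial>lborel)
      = (\<integral>\<^sup>+x. \<integral>\<^sup>+z. \<integral>\<^sup>+y. f x y z \<partial>lborel \<partial>lborel \<partial>lborel)"
    by (intro nn_integral_cong lborel_pair.Fubini') simp
  also have "\<dots> = (\<integral>\<^sup>+z. \<integral>\<^sup>+x. \<integral>\<^sup>+y. f x y z \<partial>lborel \<partial>lborel \<partial>lborel)"
    by (rule lborel_pair.Fubini') simp
  also have "\<dots> = (\<integral>\<^sup>+z. \<integral>\<^sup>+y. \<integral>\<^sup>+x. f x y z \<partial>lborel \<partial>lborel \<partial>lborel)"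
    by (intro nn_integral_cong lborel_pair.Fubini') simp
  finally show ?thesis .
qed

section \<open>Bounds for the rate of a single link, and independence of fading and
  positions\<close>

lemma borel_measurable_shannon_snr [measurable]:
  assumes [measurable]: "f \<in> borel_measurable N" "g \<in> borel_measurable N"
  shows "(\<lambda>x. shannon B (snr \<xi> (f x) (g x))) \<in> borel_measurable N"
  unfolding shannon_def snr_def by measurable

text \<open>The distance is unrestricted: at \<open>d = 0\<close> the ratio is 0 by the convention
  for division.\<close>

lemma shannon_snr_nonneg: "0 \<le> B \<Longrightarrow> 0 \<le> \<xi> \<Longrightarrow> 0 \<le> w \<Longrightarrow> 0 \<le> shannon B (snr \<xi> w d)"
  unfolding shannon_def snr_def
  by (simp add: log_def)

text \<open>From \<open>ln (1 + s) \<le> s\<close> and a distance bounded below by \<open>h\<close>: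
  the rate is at most linear in the fading power, so a finite mean of the fading suffices for
  integrability.\<close>

lemma shannon_snr_le:
  assumes "0 < B" "0 < \<xi>" "0 \<le> w" "0 < h" "h \<le> d"
  shows "shannon B (snr \<xi> w d) \<le> B * \<xi> / (h\<^sup>2 * ln 2) * w"
proof -
  have "snr \<xi> w d \<ge> 0" using assms by (simp add: snr_def)
  have "snr \<xi> w d \<le> \<xi> * w / h\<^sup>2"
    using assms unfolding snr_def by (intro divide_left_mono power_mono mult_pos_pos) auto
  moreover have "ln (1 + snr \<xi> w d) \<le> snr \<xi> w d"
    using \<open>snr \<xi> w d \<ge> 0\<close> by (rule ln_add_one_self_le_self)
  ultimately have "log 2 (1 + snr \<xi> w d) \<le> \<xi> * w / h\<^sup>2 / ln 2"
    unfolding log_def by (intro divide_right_mono) auto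
  then have "B * log 2 (1 + snr \<xi> w d) \<le> B * (\<xi> * w / h\<^sup>2 / ln 2)"
    using assms by (intro mult_left_mono) auto
  then show ?thesis by (simp add: shannon_def)
qed

text \<open>The fading is represented by a density and the finite mean \<open>W_mean\<close>; the
  shadowed-Rician form is used when that mean is verified at the interpretation.\<close>

locale satellite_downlink = satellite_cluster +
  fixes W :: "nat \<Rightarrow> 'a \<Rightarrow> real" and fW :: "real \<Rightarrow> real"
      and positions :: "'a \<Rightarrow> (nat \<Rightarrow> real^3) \<times> (nat \<Rightarrow> real^3)"
  assumes W_nonneg: "\<And>i \<omega>. i \<in> {0..NF} \<Longrightarrow> \<omega> \<in> space M \<Longrightarrow> 0 \<le> W i \<omega>"
    and fW_nonneg: "\<And>w. 0 \<le> fW w"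
    and W_distr: "\<And>i. i \<in> {0..NF} \<Longrightarrow> distributed M lborel (W i) (\<lambda>w. ennreal (fW w))"
    and W_mean: "\<And>i. i \<in> {0..NF} \<Longrightarrow> (\<integral>\<^sup>+\<omega>. ennreal (W i \<omega>) \<partial>M) < \<infinity>"
    and positions_def: "positions = (\<lambda>\<omega>. (leaders \<omega>, \<lambda>i\<in>{1..NF}. follower i \<omega>))"
    and W_indep: "indep_set
           (sets (vimage_algebra (space M) (\<lambda>\<omega>. \<lambda>i\<in>{0..NF}. W i \<omega>) (PiM {0..NF} (\<lambda>_. borel))))
           (sets (vimage_algebra (space M) positions (PiM {1..NL} (\<lambda>_. borel)
               \<Otimes>\<^sub>M PiM {1..NF} (\<lambda>_. borel))))"
begin

lemma measurable_positions [measurable]: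
  "positions \<in> measurable M (PiM {1..NL} (\<lambda>_. borel) \<Otimes>\<^sub>M PiM {1..NF} (\<lambda>_. borel))"
  unfolding positions_def
      by (intro measurable_Pair measurable_restrict measurable_leaders borel_measurable_follower)

lemma borel_measurable_W [measurable]: "i \<in> {0..NF} \<Longrightarrow> W i \<in> borel_measurable M"
  using distributed_measurable[OF W_distr[of i]] by simp

lemma borel_measurable_fW [measurable]: "fW \<in> borel_measurable borel"
proof -
  have "(\<lambda>w. enn2real (ennreal (fW w))) \<in> borel_measurable borel"
    using distributed_borel_measurable[OF W_distr[of 0]] by (intro borel_measurable_enn2real) simp
  then show ?thesis using fW_nonneg by simp
qed

text \<open>The density must vanish almost everywhere on the negative half-line because the fading
  powers are nonnegative; this restricts the fading integrals to \<open>{0..}\<close>.\<close>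

lemma AE_fW: "AE w in lborel. w < 0 \<longrightarrow> fW w = 0"
proof -
  have "(\<integral>\<^sup>+w. ennreal (fW w) * indicator {..<0} w \<partial>lborel) = (\<integral>\<^sup>+\<omega>. indicator {..<0} (W 0 \<omega>) \<partial>M)"
    by (rule distributed_nn_integral[OF W_distr]) auto
  also have "\<dots> = 0"
    using W_nonneg[of 0] by (intro nn_integral_zero' AE_I2) (auto simp: indicator_def not_less)
  finally have "AE w in lborel. ennreal (fW w) * indicator {..<0} w = 0"
    by (subst (asm) nn_integral_0_iff_AE) auto
  then show ?thesis
    using fW_nonneg by (auto simp: indicator_def ennreal_eq_0_iff intro: antisym elim!: eventually_mono)
qed

lemma nn_integral_fading:
  assumes i: "i \<in> {0..NF}"
      and K [measurable]: "case_prod K \<in> borel_measurable (borel \<Otimes>\<^sub>M (PiM {1..NL} (\<lambda>_. borel)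
      \<Otimes>\<^sub>M PiM {1..NF} (\<lambda>_. borel)))"
  shows "(\<integral>\<^sup>+\<omega>. K (W i \<omega>) (positions \<omega>) \<partial>M) =
    (\<integral>\<^sup>+w. (\<integral>\<^sup>+\<omega>. K w (positions \<omega>) \<partial>M) * ennreal (fW w) * indicator {0..} w \<partial>lborel)"
proof -
  let ?N = "PiM {1..NL} (\<lambda>_. borel) \<Otimes>\<^sub>M PiM {1..NF} (\<lambda>_. borel) :: ((nat \<Rightarrow> real^3) \<times> (nat \<Rightarrow> real^3))
      measure"
  have "(\<integral>\<^sup>+\<omega>. K (W i \<omega>) (positions \<omega>) \<partial>M) = (\<integral>\<^sup>+w. ennreal (fW w) * (\<integral>\<^sup>+\<omega>. K w (positions \<omega>)
      \<partial>M) \<partial>lborel)"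
  proof (rule nn_integral_indep_density[OF W_distr[OF i] measurable_positions _ K])
    fix A :: "real set" and B assume A: "A \<in> sets borel" and B: "B \<in> sets ?N"
    \<comment> \<open>\<open>W_indep\<close> speaks of the whole fading vector, so the event of one
      component is rewritten as an event of the vector.\<close>
    have "W i -` A \<inter> space M
        = (\<lambda>\<omega>. \<lambda>i\<in>{0..NF}. W i \<omega>) -` ((\<lambda>v. v i) -` A \<inter> space (PiM {0..NF} (\<lambda>_. borel))) \<inter> space M"
      using i by (auto simp: space_PiM)
    moreover have "(\<lambda>v. v i) -` A \<inter> space (PiM {0..NF} (\<lambda>_. borel)) \<in> sets (PiM {0..NF} (\<lambda>_. borel))"
      using A measurable_component_singleton[OF i, of "\<lambda>_. borel :: real measure"]
          by (rule measurable_sets[rotated])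
    ultimately have "W i -` A \<inter> space M \<in> sets (vimage_algebra (space M) (\<lambda>\<omega>. \<lambda>i\<in>{0..NF}. W i \<omega>)
        (PiM {0..NF} (\<lambda>_. borel)))"
      by (simp only: in_vimage_algebra)
    moreover have "positions -` B \<inter> space M \<in> sets (vimage_algebra (space M) positions ?N)"
      using B by (rule in_vimage_algebra)
    ultimately show "prob ((W i -` A \<inter> space M) \<inter> (positions -` B \<inter> space M))
        = prob (W i -` A \<inter> space M) * prob (positions -` B \<inter> space M)"
      by (rule indep_setD[OF W_indep])
  qed
  also have "\<dots> = (\<integral>\<^sup>+w. (\<integral>\<^sup>+\<omega>. K w (positions \<omega>) \<partial>M) * ennreal (fW w) * indicator {0..} w \<partial>lborel)"
    using AE_fW by (intro nn_integral_cong_AE)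
        (auto simp: mult_ac split: split_indicator elim!: eventually_mono)
  finally show ?thesis .
qed

lemma measurable_nearest_point_positions [measurable]:
  "p \<in> measurable N (PiM {1..NL} (\<lambda>_. borel) \<Otimes>\<^sub>M PiM {1..NF} (\<lambda>_. borel :: (real^3) measure)) \<Longrightarrow>
    (\<lambda>x. (fst (p x)) (nearest NL (fst (p x)) user)) \<in> borel_measurable N"
  by (rule measurable_compose[OF measurable_compose[OF _ measurable_fst]
      measurable_nearest_point[OF NL]])

lemma measurable_follower_positions [measurable]:
  "i \<in> {1..NF} \<Longrightarrow> p \<in> measurable N (PiM {1..NL} (\<lambda>_. borel :: (real^3) measure)
      \<Otimes>\<^sub>M PiM {1..NF} (\<lambda>_. borel :: (real^3) measure)) \<Longrightarrow>
    (\<lambda>x. (snd (p x)) i) \<in> borel_measurable N"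
  by (rule measurable_compose[OF measurable_compose[OF _ measurable_snd] measurable_component_singleton])

lemma nn_integral_leader_rate:
  assumes k [measurable]: "(\<lambda>x. k (fst (fst x)) (snd (fst x)) (snd x))
      \<in> borel_measurable ((borel \<Otimes>\<^sub>M borel) \<Otimes>\<^sub>M borel)"
  shows "(\<integral>\<^sup>+\<omega>. k (W 0 \<omega>) (\<Theta> \<omega>) (dist (assoc \<omega>) user) \<partial>M) =
    (\<integral>\<^sup>+\<theta>. \<integral>\<^sup>+w. ennreal (f_LU NL \<theta>) * indicator {0..pi} \<theta> * k w \<theta> (r_LU (norm user) R \<theta>)
        * ennreal (fW w) * indicator {0..} w \<partial>lborel \<partial>lborel)"
proof -
  have k': "case_prod (case_prod k) \<in> borel_measurable ((borel \<Otimes>\<^sub>M borel) \<Otimes>\<^sub>M borel)"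
    using k by (simp add: case_prod_unfold)
  note [measurable] = measurable_compose_3[OF k']
  let ?a = "\<lambda>p. (fst p) (nearest NL (fst p) user) :: real^3"
  have a: "assoc \<omega> = ?a (positions \<omega>)" for \<omega>
    by (simp add: assoc_eq positions_def)
  have "(\<integral>\<^sup>+\<omega>. k (W 0 \<omega>) (\<Theta> \<omega>) (dist (assoc \<omega>) user) \<partial>M)
     = (\<integral>\<^sup>+\<omega>. (\<lambda>w p. k w (central_angle (?a p) user) (dist (?a p) user)) (W 0 \<omega>) (positions \<omega>) \<partial>M)"
    by (simp add: a)
  also have "\<dots> = (\<integral>\<^sup>+w. (\<integral>\<^sup>+\<omega>. k w (\<Theta> \<omega>) (dist (assoc \<omega>) user) \<partial>M) * ennreal (fW w)
      * indicator {0..} w \<partial>lborel)"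
    unfolding a
    by (rule nn_integral_fading, simp, unfold case_prod_unfold)
       (intro measurable_compose_3[OF k'] borel_measurable_central_angle borel_measurable_dist
          measurable_nearest_point_positions measurable_fst measurable_snd measurable_const
              borel_measurable_const)
  also have "\<dots> = (\<integral>\<^sup>+w. (\<integral>\<^sup>+\<theta>. ennreal (f_LU NL \<theta>) * indicator {0..pi} \<theta>
      * k w \<theta> (r_LU (norm user) R \<theta>) \<partial>lborel) * ennreal (fW w) * indicator {0..} w \<partial>lborel)"
    by (subst nn_integral_angle) (auto simp: case_prod_unfold)
  also have "\<dots> = (\<integral>\<^sup>+w. \<integral>\<^sup>+\<theta>. ennreal (f_LU NL \<theta>) * indicator {0..pi} \<theta>
      * k w \<theta> (r_LU (norm user) R \<theta>) * ennreal (fW w) * indicator {0..} w \<partial>lborel \<partial>lborel)"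
    by (intro nn_integral_cong) (simp add: nn_integral_multc)
  also have "\<dots> = (\<integral>\<^sup>+\<theta>. \<integral>\<^sup>+w. ennreal (f_LU NL \<theta>) * indicator {0..pi} \<theta>
      * k w \<theta> (r_LU (norm user) R \<theta>) * ennreal (fW w) * indicator {0..} w \<partial>lborel \<partial>lborel)"
    by (rule lborel_pair.Fubini') (simp add: case_prod_unfold)
  finally show ?thesis .
qed

lemma nn_integral_follower_rate:
  fixes B1 B2 \<xi>1 \<xi>2 v \<theta>max :: real
  assumes i: "i \<in> {1..NF}" and \<theta>max: "\<theta>max \<le> pi"
  defines "k \<equiv> \<lambda>w d d'. min (shannon B1 (snr \<xi>1 v d)) (shannon B2 (snr \<xi>2 w d'))"
  shows "(\<integral>\<^sup>+\<omega>. ennreal (indicator {..\<theta>max} (\<Theta> \<omega>)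
      * k (W i \<omega>) (dist (assoc \<omega>) (follower i \<omega>)) (dist (follower i \<omega>) user)) \<partial>M) =
    (\<integral>\<^sup>+w. (\<integral>\<^sup>+\<phi>. (\<integral>\<^sup>+\<psi>. (\<integral>\<^sup>+\<theta>.
        ennreal (sin \<psi> * f_LU NL \<theta> / (2 * pi * (1 - cos \<theta>cap))
            * k w (r_LF R \<psi>) (r_FU (norm user) R \<theta> \<psi> \<phi>)) * indicator {0..\<theta>max} \<theta> \<partial>lborel)
        * indicator {0..\<theta>cap} \<psi> \<partial>lborel) * indicator {0..2*pi} \<phi> \<partial>lborel)
        * ennreal (fW w) * indicator {0..} w \<partial>lborel)"
proof -
  have C: "0 < 1 - cos \<theta>cap" using cap_density_pos[OF R cap] by simp
  have [measurable]: "(\<lambda>x. k (f x) (g x) (h x)) \<in> borel_measurable N"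
    if [measurable]: "f \<in> borel_measurable N" "g \<in> borel_measurable N" "h \<in> borel_measurable N"
    for f g h and N :: "'z measure"
    unfolding k_def by measurable
  let ?a = "\<lambda>p. (fst p) (nearest NL (fst p) user) :: real^3" and ?b = "\<lambda>p. (snd p) i :: real^3"
  have a: "assoc \<omega> = ?a (positions \<omega>)" and b: "follower i \<omega> = ?b (positions \<omega>)" for \<omega>
    using i by (simp_all add: assoc_eq positions_def)
  let ?j = "\<lambda>w \<theta> d d'. ennreal (indicator {..\<theta>max} \<theta> * k w d d')"
  have "(\<integral>\<^sup>+\<omega>. ?j (W i \<omega>) (\<Theta> \<omega>) (dist (assoc \<omega>) (follower i \<omega>)) (dist (follower i \<omega>) user) \<partial>M)
     = (\<integral>\<^sup>+\<omega>. (\<lambda>w p. ?j w (central_angle (?a p) user) (dist (?a p) (?b p)) (dist (?b p) user))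
         (W i \<omega>) (positions \<omega>) \<partial>M)"
    by (simp only: a b)
  also have "\<dots> = (\<integral>\<^sup>+w. (\<integral>\<^sup>+\<omega>. ?j w (\<Theta> \<omega>) (dist (assoc \<omega>) (follower i \<omega>)) (dist (follower i \<omega>) user) \<partial>M)
      * ennreal (fW w) * indicator {0..} w \<partial>lborel)"
    unfolding a b using i
    by (intro nn_integral_fading, simp, unfold case_prod_unfold) measurable
  also have "\<dots> = (\<integral>\<^sup>+w. (\<integral>\<^sup>+\<phi>. (\<integral>\<^sup>+\<psi>. (\<integral>\<^sup>+\<theta>.
        ennreal (sin \<psi> * f_LU NL \<theta> / (2 * pi * (1 - cos \<theta>cap))
            * k w (r_LF R \<psi>) (r_FU (norm user) R \<theta> \<psi> \<phi>)) * indicator {0..\<theta>max} \<theta> \<partial>lborel)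
        * indicator {0..\<theta>cap} \<psi> \<partial>lborel) * indicator {0..2*pi} \<phi> \<partial>lborel)
        * ennreal (fW w) * indicator {0..} w \<partial>lborel)"
  proof (intro nn_integral_cong arg_cong2[where f = "(*)"] refl)
    fix w :: real
    let ?s = "\<lambda>\<psi>. sin \<psi> / (2 * pi * (1 - cos \<theta>cap))"
    have "(\<integral>\<^sup>+\<omega>. ?j w (\<Theta> \<omega>) (dist (assoc \<omega>) (follower i \<omega>)) (dist (follower i \<omega>) user) \<partial>M)
       = (\<integral>\<^sup>+\<theta>. \<integral>\<^sup>+\<psi>. \<integral>\<^sup>+\<phi>. ennreal (f_LU NL \<theta>) * indicator {0..pi} \<theta> *
          (ennreal (?s \<psi>) * indicator {0..\<theta>cap} \<psi> * indicator {0..2*pi} \<phi> *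
            ?j w \<theta> (r_LF R \<psi>) (r_FU (norm user) R \<theta> \<psi> \<phi>)) \<partial>lborel \<partial>lborel \<partial>lborel)"
      by (rule nn_integral_follower[OF i]) (unfold case_prod_unfold, measurable)
    also have "\<dots> = (\<integral>\<^sup>+\<theta>. \<integral>\<^sup>+\<psi>. \<integral>\<^sup>+\<phi>.
        ennreal (sin \<psi> * f_LU NL \<theta> / (2 * pi * (1 - cos \<theta>cap))
            * k w (r_LF R \<psi>) (r_FU (norm user) R \<theta> \<psi> \<phi>))
        * indicator {0..\<theta>max} \<theta> * indicator {0..\<theta>cap} \<psi> * indicator {0..2*pi} \<phi> \<partial>lborel \<partial>lborel \<partial>lborel)"
    proof (intro nn_integral_cong)
      fix \<theta> \<psi> \<phi> :: real
      show "ennreal (f_LU NL \<theta>) * indicator {0..pi} \<theta> *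
          (ennreal (?s \<psi>) * indicator {0..\<theta>cap} \<psi> * indicator {0..2*pi} \<phi>
              * ?j w \<theta> (r_LF R \<psi>) (r_FU (norm user) R \<theta> \<psi> \<phi>))
        = ennreal (sin \<psi> * f_LU NL \<theta> / (2 * pi * (1 - cos \<theta>cap))
            * k w (r_LF R \<psi>) (r_FU (norm user) R \<theta> \<psi> \<phi>))
        * indicator {0..\<theta>max} \<theta> * indicator {0..\<theta>cap} \<psi> * indicator {0..2*pi} \<phi>"
      \<comment> \<open>\<open>ennreal\<close> cuts off negative values, so the product may be split
        only where the weights are nonnegative; this holds inside the angular ranges, and outside
        both sides are 0. The rate factor may have either sign, since \<open>w\<close> is arbitrary
        here.\<close>
      proof (cases "\<theta> \<in> {0..\<theta>max} \<and> \<psi> \<in> {0..\<theta>cap}")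
        case True
        then have "0 \<le> f_LU NL \<theta>" "0 \<le> ?s \<psi>"
          using \<theta>max cap C by (auto intro!: f_LU_nonneg divide_nonneg_nonneg sin_ge_zero)
        moreover have "sin \<psi> * f_LU NL \<theta> / (2 * pi * (1 - cos \<theta>cap)) = f_LU NL \<theta> * ?s \<psi>"
          by simp
        ultimately have eq: "ennreal (sin \<psi> * f_LU NL \<theta> / (2 * pi * (1 - cos \<theta>cap)) * x)
            = ennreal (f_LU NL \<theta>) * (ennreal (?s \<psi>) * ennreal x)" for x
          by (simp only: ennreal_mult' mult.assoc)
        show ?thesis
          unfolding eq using True \<theta>max by (simp add: mult_ac)
      next
        case False
        then show ?thesis by (auto split: split_indicator)
      qed
    qed
    also have "\<dots> = (\<integral>\<^sup>+\<phi>. \<integral>\<^sup>+\<psi>. \<integral>\<^sup>+\<theta>.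
        ennreal (sin \<psi> * f_LU NL \<theta> / (2 * pi * (1 - cos \<theta>cap))
            * k w (r_LF R \<psi>) (r_FU (norm user) R \<theta> \<psi> \<phi>))
        * indicator {0..\<theta>max} \<theta> * indicator {0..\<theta>cap} \<psi> * indicator {0..2*pi} \<phi> \<partial>lborel \<partial>lborel \<partial>lborel)"
      by (rule nn_integral_rotate_3) (unfold case_prod_unfold, measurable)
    also have "\<dots> = (\<integral>\<^sup>+\<phi>. (\<integral>\<^sup>+\<psi>. (\<integral>\<^sup>+\<theta>.
        ennreal (sin \<psi> * f_LU NL \<theta> / (2 * pi * (1 - cos \<theta>cap))
            * k w (r_LF R \<psi>) (r_FU (norm user) R \<theta> \<psi> \<phi>)) * indicator {0..\<theta>max} \<theta> \<partial>lborel)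
        * indicator {0..\<theta>cap} \<psi> \<partial>lborel) * indicator {0..2*pi} \<phi> \<partial>lborel)"
      by (simp add: nn_integral_multc)
    finally show "(\<integral>\<^sup>+\<omega>. ?j w (\<Theta> \<omega>) (dist (assoc \<omega>) (follower i \<omega>)) (dist (follower i \<omega>) user) \<partial>M) = \<dots>" .
  qed
  finally show ?thesis .
qed

section \<open>Expected rates as nested Bochner integrals\<close>

lemma integrable_dominated_by_W:
  assumes i: "i \<in> {0..NF}" and [measurable]: "X \<in> borel_measurable M"
    and X: "AE \<omega> in M. 0 \<le> X \<omega> \<and> X \<omega> \<le> c * W i \<omega>"
  shows "integrable M X" "integral\<^sup>L M X = enn2real (\<integral>\<^sup>+\<omega>. ennreal (X \<omega>) \<partial>M)"
    "(\<integral>\<^sup>+\<omega>. ennreal (X \<omega>) \<partial>M) < \<infinity>"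
proof -
  have "integrable M (W i)"
    using i W_mean[OF i] W_nonneg by (intro integrableI_nonneg) (auto intro!: AE_I2)
  then have "integrable M (\<lambda>\<omega>. c * W i \<omega>)" by simp
  then show *: "integrable M X"
  proof (rule Bochner_Integration.integrable_bound)
    show "AE \<omega> in M. norm (X \<omega>) \<le> norm (c * W i \<omega>)"
      using X
    proof eventually_elim
      case (elim \<omega>)
      then show ?case using abs_ge_self[of "c * W i \<omega>"] unfolding real_norm_def by linarith
    qed
  qed simp
  show "integral\<^sup>L M X = enn2real (\<integral>\<^sup>+\<omega>. ennreal (X \<omega>) \<partial>M)"
    using X by (intro integral_eq_nn_integral) (auto elim!: eventually_mono)
  have "(\<integral>\<^sup>+\<omega>. ennreal (X \<omega>) \<partial>M) = ennreal (integral\<^sup>L M X)"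
    using X by (intro nn_integral_eq_integral[OF *]) (auto elim!: eventually_mono)
  then show "(\<integral>\<^sup>+\<omega>. ennreal (X \<omega>) \<partial>M) < \<infinity>" by simp
qed

lemma dist_user_ge: "norm x = R \<Longrightarrow> R - norm user \<le> dist x user"
  using norm_triangle_ineq2[of x user] by (simp add: dist_norm)

lemma leader_rate:
  fixes B \<xi> \<theta>max :: real
  assumes pos: "0 < B" "0 < \<xi>" and \<theta>max: "\<theta>max \<le> pi"
  defines "X \<equiv> \<lambda>\<omega>. indicator {..\<theta>max} (\<Theta> \<omega>) * shannon B (snr \<xi> (W 0 \<omega>) (dist (assoc \<omega>) user))"
  shows "integrable M X"
    and "integral\<^sup>L M X = (LBINT \<theta>:{0..\<theta>max}. LBINT w:{0..}. fW w * f_LU NL \<theta>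
        * shannon B (snr \<xi> w (r_LU (norm user) R \<theta>)))"
proof -
  let ?h = "R - norm user"
  have h: "0 < ?h" using user by simp
  have [measurable]: "X \<in> borel_measurable M" unfolding X_def by measurable
  \<comment> \<open>Almost surely the leader is at distance at least \<open>R - norm user\<close>
    from the user, so its rate is at most a constant times the fading power.\<close>
  have bd: "AE \<omega> in M. 0 \<le> X \<omega> \<and> X \<omega> \<le> B * \<xi> / (?h\<^sup>2 * ln 2) * W 0 \<omega>"
    using AE_norm_assoc AE_space
  proof eventually_elim
    case (elim \<omega>)
    have W: "0 \<le> W 0 \<omega>" using W_nonneg[of 0 \<omega>] elim by simp
    show ?case
      using shannon_snr_le[OF pos W h dist_user_ge[of "assoc \<omega>"]] shannon_snr_nonneg[of B \<xi> "W 0 \<omega>"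
          "dist (assoc \<omega>) user"] pos W elim
      by (auto simp: X_def indicator_def)
  qed
  note X = integrable_dominated_by_W[of 0, OF _ _ bd, simplified]
  show "integrable M X" by (rule X)
  let ?g = "\<lambda>\<theta> w. fW w * f_LU NL \<theta> * shannon B (snr \<xi> w (r_LU (norm user) R \<theta>))"
  let ?h = "\<lambda>\<theta>. \<integral>\<^sup>+w. ennreal (?g \<theta> w) * indicator {0..} w \<partial>lborel"
  have "(\<integral>\<^sup>+\<omega>. ennreal (X \<omega>) \<partial>M) = (\<integral>\<^sup>+\<omega>. (\<lambda>w \<theta> d. ennreal (indicator {..\<theta>max} \<theta>
      * shannon B (snr \<xi> w d))) (W 0 \<omega>) (\<Theta> \<omega>) (dist (assoc \<omega>) user) \<partial>M)"
    by (simp add: X_def)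
  also have "\<dots> = (\<integral>\<^sup>+\<theta>. \<integral>\<^sup>+w. ennreal (f_LU NL \<theta>) * indicator {0..pi} \<theta> *
       ennreal (indicator {..\<theta>max} \<theta> * shannon B (snr \<xi> w (r_LU (norm user) R \<theta>))) * ennreal (fW w)
           * indicator {0..} w \<partial>lborel \<partial>lborel)"
    by (rule nn_integral_leader_rate) measurable
  also have "\<dots> = (\<integral>\<^sup>+\<theta>. \<integral>\<^sup>+w. ennreal (?g \<theta> w) * indicator {0..} w
      * indicator {0..\<theta>max} \<theta> \<partial>lborel \<partial>lborel)"
  proof (intro nn_integral_cong)
    fix \<theta> w :: real
    show "ennreal (f_LU NL \<theta>) * indicator {0..pi} \<theta> *
       ennreal (indicator {..\<theta>max} \<theta> * shannon B (snr \<xi> w (r_LU (norm user) R \<theta>))) * ennreal (fW w)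
           * indicator {0..} w
       = ennreal (?g \<theta> w) * indicator {0..} w * indicator {0..\<theta>max} \<theta>"
    proof (cases "\<theta> \<in> {0..\<theta>max}")
      case True
      then have "0 \<le> f_LU NL \<theta>" using \<theta>max by (intro f_LU_nonneg) auto
      then have "ennreal (?g \<theta> w) = ennreal (fW w) * (ennreal (f_LU NL \<theta>)
          * ennreal (shannon B (snr \<xi> w (r_LU (norm user) R \<theta>))))"
        using fW_nonneg by (simp only: ennreal_mult' mult.assoc)
      then show ?thesis using True \<theta>max by (simp add: mult_ac)
    qed (auto split: split_indicator)
  qed
  also have "\<dots> = (\<integral>\<^sup>+\<theta>. ?h \<theta> * indicator {0..\<theta>max} \<theta> \<partial>lborel)"
    by (simp add: nn_integral_multc)
  finally have eq: "(\<integral>\<^sup>+\<omega>. ennreal (X \<omega>) \<partial>M) = (\<integral>\<^sup>+\<theta>. ?h \<theta> * indicator {0..\<theta>max} \<theta> \<partial>lborel)" .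
  have "(LBINT \<theta>:{0..\<theta>max}. LBINT w:{0..}. ?g \<theta> w) = enn2real (\<integral>\<^sup>+\<theta>. ?h \<theta>
      * indicator {0..\<theta>max} \<theta> \<partial>lborel)"
  proof (rule set_lebesgue_integral_eq_enn2real)
    show "(\<lambda>\<theta>. LBINT w:{0..}. ?g \<theta> w) \<in> borel_measurable lborel"
      unfolding set_lebesgue_integral_def by measurable
    show "(LBINT w:{0..}. ?g \<theta> w) = enn2real (?h \<theta>)" if "\<theta> \<in> {0..\<theta>max}" for \<theta>
      using that \<theta>max pos fW_nonneg
      by (intro set_lebesgue_integral_eq_nn_integral)
          (auto intro!: mult_nonneg_nonneg f_LU_nonneg shannon_snr_nonneg)
    show "(\<integral>\<^sup>+\<theta>. ?h \<theta> * indicator {0..\<theta>max} \<theta> \<partial>lborel) < \<infinity>"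
      using X(3) unfolding eq by simp
  qed measurable
  then show "integral\<^sup>L M X = (LBINT \<theta>:{0..\<theta>max}. LBINT w:{0..}. ?g \<theta> w)"
    using X(2) by (simp only: eq)
qed

lemma follower_rate:
  fixes B1 B2 \<xi>1 \<xi>2 v \<theta>max :: real
  assumes i: "i \<in> {1..NF}" and pos: "0 < B1" "0 < B2" "0 < \<xi>1" "0 < \<xi>2" "0 \<le> v" and \<theta>max: "\<theta>max \<le> pi"
  defines "k \<equiv> \<lambda>w d d'. min (shannon B1 (snr \<xi>1 v d)) (shannon B2 (snr \<xi>2 w d'))"
  defines "X \<equiv> \<lambda>\<omega>. indicator {..\<theta>max} (\<Theta> \<omega>)
      * k (W i \<omega>) (dist (assoc \<omega>) (follower i \<omega>)) (dist (follower i \<omega>) user)"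
  shows "integrable M X"
    and "integral\<^sup>L M X = (LBINT w:{0..}. (LBINT \<phi>:{0..2*pi}. LBINT \<psi>:{0..\<theta>cap}. LBINT \<theta>:{0..\<theta>max}.
       sin \<psi> * f_LU NL \<theta> / (2 * pi * (1 - cos \<theta>cap)) * k w (r_LF R \<psi>) (r_FU (norm user) R \<theta> \<psi> \<phi>))
           * fW w)"
proof -
  let ?h = "R - norm user"
  have h: "0 < ?h" using user by simp
  have C: "0 < 1 - cos \<theta>cap" using cap_density_pos[OF R cap] by simp
  have i0: "i \<in> {0..NF}" using i by simp
  have [measurable]: "(\<lambda>x. k (f x) (g x) (h x)) \<in> borel_measurable N"
    if [measurable]: "f \<in> borel_measurable N" "g \<in> borel_measurable N" "h \<in> borel_measurable N"
    for f g h and N :: "'z measure"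
    unfolding k_def by measurable
  have k_nonneg: "0 \<le> k w d d'" if "0 \<le> w" for w d d'
    using that pos by (simp add: k_def shannon_snr_nonneg)
  have [measurable]: "X \<in> borel_measurable M" unfolding X_def using i i0 by measurable
  \<comment> \<open>The minimum is bounded by its follower-user argument: that distance stays above
    \<open>R - norm user\<close>, whereas the leader-follower distance may be arbitrarily
    small.\<close>
  have bd: "AE \<omega> in M. 0 \<le> X \<omega> \<and> X \<omega> \<le> B2 * \<xi>2 / (?h\<^sup>2 * ln 2) * W i \<omega>"
    using AE_norm_follower[OF i] AE_space
  proof eventually_elim
    case (elim \<omega>)
    have W: "0 \<le> W i \<omega>" using W_nonneg[OF i0] elim by simp
    have "k (W i \<omega>) (dist (assoc \<omega>) (follower i \<omega>)) (dist (follower i \<omega>) user) \<le> B2 * \<xi>2 / (?h\<^sup>2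
        * ln 2) * W i \<omega>"
      using shannon_snr_le[OF pos(2,4) W h dist_user_ge[of "follower i \<omega>"]] elim
          by (auto simp: k_def intro: min.coboundedI2)
    then show ?case
      using k_nonneg[OF W, of "dist (assoc \<omega>) (follower i \<omega>)" "dist (follower i \<omega>) user"]
      by (auto simp: X_def indicator_def)
  qed
  note X = integrable_dominated_by_W[OF i0 _ bd, simplified]
  show "integrable M X" by (rule X)
  let ?g = "\<lambda>w \<phi> \<psi> \<theta>. sin \<psi> * f_LU NL \<theta> / (2 * pi * (1 - cos \<theta>cap))
      * k w (r_LF R \<psi>) (r_FU (norm user) R \<theta> \<psi> \<phi>)"
  let ?h1 = "\<lambda>w \<phi> \<psi>. \<integral>\<^sup>+\<theta>. ennreal (?g w \<phi> \<psi> \<theta>) * indicator {0..\<theta>max} \<theta> \<partial>lborel"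
  let ?h2 = "\<lambda>w \<phi>. \<integral>\<^sup>+\<psi>. ?h1 w \<phi> \<psi> * indicator {0..\<theta>cap} \<psi> \<partial>lborel"
  let ?h3 = "\<lambda>w. \<integral>\<^sup>+\<phi>. ?h2 w \<phi> * indicator {0..2*pi} \<phi> \<partial>lborel"
  let ?E = "\<lambda>w. LBINT \<phi>:{0..2*pi}. LBINT \<psi>:{0..\<theta>cap}. LBINT \<theta>:{0..\<theta>max}. ?g w \<phi> \<psi> \<theta>"
  have eq: "(\<integral>\<^sup>+\<omega>. ennreal (X \<omega>) \<partial>M) = (\<integral>\<^sup>+w. ?h3 w * ennreal (fW w) * indicator {0..} w \<partial>lborel)"
    unfolding X_def k_def by (rule nn_integral_follower_rate[OF i \<theta>max])
  \<comment> \<open>The three angular layers are peeled off from outside; at each layer a finite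
    integral makes the next inner one finite almost everywhere.\<close>
  have E: "?E w = enn2real (?h3 w)" if w: "0 \<le> w" and fin: "?h3 w < \<infinity>" for w
  proof (rule set_lebesgue_integral_eq_enn2real)
    show "(\<lambda>\<phi>. LBINT \<psi>:{0..\<theta>cap}. LBINT \<theta>:{0..\<theta>max}. ?g w \<phi> \<psi> \<theta>) \<in> borel_measurable lborel"
      unfolding set_lebesgue_integral_def by measurable
    fix \<phi> :: real assume fin2: "?h2 w \<phi> < \<infinity>"
    show "(LBINT \<psi>:{0..\<theta>cap}. LBINT \<theta>:{0..\<theta>max}. ?g w \<phi> \<psi> \<theta>) = enn2real (?h2 w \<phi>)"
    proof (rule set_lebesgue_integral_eq_enn2real)
      show "(\<lambda>\<psi>. LBINT \<theta>:{0..\<theta>max}. ?g w \<phi> \<psi> \<theta>) \<in> borel_measurable lborel"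
        unfolding set_lebesgue_integral_def by measurable
      fix \<psi> assume psi: "\<psi> \<in> {0..\<theta>cap}"
      show "(LBINT \<theta>:{0..\<theta>max}. ?g w \<phi> \<psi> \<theta>) = enn2real (?h1 w \<phi> \<psi>)"
        using psi cap C \<theta>max w
        by (intro set_lebesgue_integral_eq_nn_integral)
           (auto intro!: mult_nonneg_nonneg divide_nonneg_nonneg f_LU_nonneg k_nonneg sin_ge_zero)
    qed (use fin2 in measurable)
  qed (use fin in measurable)
  have "(LBINT w:{0..}. ?E w * fW w) = enn2real (\<integral>\<^sup>+w. ?h3 w * ennreal (fW w)
      * indicator {0..} w \<partial>lborel)"
  proof (rule set_lebesgue_integral_eq_enn2real)
    show "(\<lambda>w. ?E w * fW w) \<in> borel_measurable lborel"
      unfolding set_lebesgue_integral_def by measurable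
    fix w :: real assume w: "w \<in> {0..}" and fin: "?h3 w * ennreal (fW w) < \<infinity>"
    show "?E w * fW w = enn2real (?h3 w * ennreal (fW w))"
    \<comment> \<open>Where the density vanishes, \<open>?h3 w\<close> may be infinite although its
      product with the density is 0; there both sides are 0 without any information on
      \<open>?E w\<close>.\<close>
    proof (cases "fW w = 0")
      case False
      then have "?h3 w < \<infinity>"
        using fin fW_nonneg[of w] by (auto simp: ennreal_mult_less_top ennreal_eq_0_iff)
      then have "?E w = enn2real (?h3 w)" using w by (intro E) auto
      then show ?thesis using fW_nonneg by (simp only: enn2real_mult enn2real_ennreal)
    qed simp
  next
    show "(\<integral>\<^sup>+w. ?h3 w * ennreal (fW w) * indicator {0..} w \<partial>lborel) < \<infinity>"
      using X(3) unfolding eq by simp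
  qed measurable
  then show "integral\<^sup>L M X = (LBINT w:{0..}. ?E w * fW w)"
    using X(2) by (simp only: eq)
qed

text \<open>Linearity of expectation, justified by the integrability of every single rate; the
  expectation of a follower term does not depend on its index, hence the factor
  \<open>NF\<close>.\<close>

lemma average_rate:
  fixes B1 B2 B0 \<xi>1 \<xi>2 \<xi>0 v \<theta>max :: real
  assumes pos: "0 < B1" "0 < B2" "0 < B0" "0 < \<xi>1" "0 < \<xi>2" "0 < \<xi>0" "0 \<le> v" and \<theta>max: "\<theta>max \<le> pi"
  shows "expectation (\<lambda>\<omega>. indicator {\<omega>. \<Theta> \<omega> \<le> \<theta>max} \<omega> *
      ((\<Sum>i=1..NF. min (shannon B1 (snr \<xi>1 v (dist (assoc \<omega>) (follower i \<omega>))))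
           (shannon B2 (snr \<xi>2 (W i \<omega>) (dist (follower i \<omega>) user))))
        + shannon B0 (snr \<xi>0 (W 0 \<omega>) (dist (assoc \<omega>) user)))) =
    real NF * (LBINT w:{0..}. (LBINT \<phi>:{0..2*pi}. LBINT \<psi>:{0..\<theta>cap}. LBINT \<theta>:{0..\<theta>max}.
       sin \<psi> * f_LU NL \<theta> / (2 * pi * (1 - cos \<theta>cap)) *
         min (shannon B1 (snr \<xi>1 v (r_LF R \<psi>))) (shannon B2 (snr \<xi>2 w (r_FU (norm user) R \<theta> \<psi> \<phi>))))
             * fW w)
    + (LBINT \<theta>:{0..\<theta>max}. LBINT w:{0..}. fW w * f_LU NL \<theta>
        * shannon B0 (snr \<xi>0 w (r_LU (norm user) R \<theta>)))"
proof -
  let ?X = "\<lambda>i \<omega>. indicator {..\<theta>max} (\<Theta> \<omega>) * min (shannon B1 (snr \<xi>1 v (dist (assoc \<omega>) (follower i \<omega>))))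
           (shannon B2 (snr \<xi>2 (W i \<omega>) (dist (follower i \<omega>) user)))"
  let ?Y = "\<lambda>\<omega>. indicator {..\<theta>max} (\<Theta> \<omega>) * shannon B0 (snr \<xi>0 (W 0 \<omega>) (dist (assoc \<omega>) user))"
  note X = follower_rate[OF _ pos(1,2,4,5,7) \<theta>max] and Y = leader_rate[OF pos(3,6) \<theta>max]
  have "expectation (\<lambda>\<omega>. (\<Sum>i=1..NF. ?X i \<omega>) + ?Y \<omega>) = (\<Sum>i=1..NF. expectation (?X i)) + expectation ?Y"
    by (simp only: Bochner_Integration.integral_add[OF Bochner_Integration.integrable_sum[OF X(1)] Y(1)]
        Bochner_Integration.integral_sum[OF X(1)])
  also have "(\<Sum>i=1..NF. expectation (?X i))
      = (\<Sum>i=1..NF. (LBINT w:{0..}. (LBINT \<phi>:{0..2*pi}. LBINT \<psi>:{0..\<theta>cap}. LBINT \<theta>:{0..\<theta>max}.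
       sin \<psi> * f_LU NL \<theta> / (2 * pi * (1 - cos \<theta>cap)) *
         min (shannon B1 (snr \<xi>1 v (r_LF R \<psi>))) (shannon B2 (snr \<xi>2 w (r_FU (norm user) R \<theta> \<psi> \<phi>))))
             * fW w))"
    by (intro sum.cong refl X(2))
  also have "(\<lambda>\<omega>. (\<Sum>i=1..NF. ?X i \<omega>) + ?Y \<omega>) = (\<lambda>\<omega>. indicator {\<omega>. \<Theta> \<omega> \<le> \<theta>max} \<omega> *
      ((\<Sum>i=1..NF. min (shannon B1 (snr \<xi>1 v (dist (assoc \<omega>) (follower i \<omega>))))
           (shannon B2 (snr \<xi>2 (W i \<omega>) (dist (follower i \<omega>) user))))
        + shannon B0 (snr \<xi>0 (W 0 \<omega>) (dist (assoc \<omega>) user))))"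
    by (auto simp: fun_eq_iff indicator_def sum_distrib_left distrib_left)
  finally show ?thesis
    by (simp only: Y(2) sum_constant card_atLeastAtMost diff_Suc_1)
qed

end

theorem theorem4:
  fixes M :: "'a measure"
    and Rearth hsat Rsat \<theta>cap \<theta>max :: real
    and NL NF :: nat
    and user :: "real^3"
    and leader follower :: "nat \<Rightarrow> 'a \<Rightarrow> real^3"
    and assoc :: "'a \<Rightarrow> real^3"
    and leaders :: "'a \<Rightarrow> nat \<Rightarrow> real^3"
    and leader_space follower_space :: "(nat \<Rightarrow> real^3) measure"
    and positions :: "'a \<Rightarrow> (nat \<Rightarrow> real^3) \<times> (nat \<Rightarrow> real^3)"
    and \<rho> G \<nu> B \<xi> :: "link \<Rightarrow> real"
    and \<zeta> \<sigma> :: "receiver \<Rightarrow> real"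
    and WU :: "nat \<Rightarrow> 'a \<Rightarrow> real"
    and WF :: real
    and fW :: "real \<Rightarrow> real"
    and \<Omega> b0 m :: real
    and SNR_LU :: "'a \<Rightarrow> real"
    and SNR_FU SNR_LF :: "nat \<Rightarrow> 'a \<Rightarrow> real"
    and R_LFs R_LU :: real
    and R_LF :: "real \<Rightarrow> real"
    and R_FU :: "real \<Rightarrow> real \<Rightarrow> real \<Rightarrow> real \<Rightarrow> real"
    and E :: "real \<Rightarrow> real"
  assumes "prob_space M"
    \<comment> \<open>geometry\<close>
    and "Rearth > 0" and "hsat > 0"
  defines "Rsat \<equiv> Rearth + hsat"
  assumes "norm user = Rearth"
    and "NL \<ge> 1" and "NF \<ge> 1"
    and "\<theta>cap > 0"
    and "0 < \<theta>max" and "\<theta>max \<le> arccos (Rearth / Rsat) - \<theta>cap"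
    \<comment> \<open>leaders\<close>
    and "prob_space.indep_vars M (\<lambda>_. borel) leader {1..NL}"
    and "\<And>j. j \<in> {1..NL} \<Longrightarrow> distr M borel (leader j) = uniform_sphere Rsat"
  defines "leaders \<equiv> \<lambda>\<omega>. \<lambda>j\<in>{1..NL}. leader j \<omega>"
    and "leader_space \<equiv> PiM {1..NL} (\<lambda>_. borel)"
    and "assoc \<equiv> \<lambda>\<omega>. leader (nearest NL (\<lambda>j. leader j \<omega>) user) \<omega>"
    \<comment> \<open>followers\<close>
  assumes "cond_iid M (vimage_algebra (space M) leaders leader_space) {1..NF} follower
             (\<lambda>\<omega>. uniform_cap Rsat \<theta>cap (assoc \<omega>))"
  defines "follower_space \<equiv> PiM {1..NF} (\<lambda>_. borel)"
    and "positions \<equiv> \<lambda>\<omega>. (leaders \<omega>, \<lambda>i\<in>{1..NF}. follower i \<omega>)"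
    \<comment> \<open>channel\<close>
  assumes "\<And>q. \<rho> q > 0" and "\<And>q. G q > 0" and "\<And>q. \<nu> q > 0" and "\<And>q. B q > 0"
    and "\<And>d. \<zeta> d > 0" and "\<And>d. \<sigma> d > 0" and "\<zeta> Follower = 1"
    and "WF = 1"
  defines "\<xi> \<equiv> link_const \<rho> G \<zeta> \<sigma> \<nu>"
    \<comment> \<open>fading\<close>
  assumes "\<Omega> > 0" and "b0 > 0" and "m > 0"
    and "\<And>i \<omega>. i \<in> {0..NF} \<Longrightarrow> \<omega> \<in> space M \<Longrightarrow> WU i \<omega> \<ge> 0"
    and "\<And>w. fW w \<ge> 0"
    and "\<And>i. i \<in> {0..NF} \<Longrightarrow> distributed M lborel (WU i) (\<lambda>w. ennreal (fW w))"
    and "\<And>i w. i \<in> {0..NF} \<Longrightarrow> w \<ge> 0 \<Longrightarrow>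
           measure M {\<omega>\<in>space M. WU i \<omega> \<le> w} = shadowed_rician_cdf \<Omega> b0 m w"
    and "prob_space.indep_vars M (\<lambda>_. borel) WU {0..NF}"
    and "prob_space.indep_set M
           (sets (vimage_algebra (space M) (\<lambda>\<omega>. \<lambda>i\<in>{0..NF}. WU i \<omega>) (PiM {0..NF} (\<lambda>_. borel))))
           (sets (vimage_algebra (space M) positions (leader_space \<Otimes>\<^sub>M follower_space)))"
    \<comment> \<open>the average data rate\<close>
  defines "SNR_LU \<equiv> \<lambda>\<omega>. snr (\<xi> LU) (WU 0 \<omega>) (dist (assoc \<omega>) user)"
    and "SNR_FU \<equiv> \<lambda>i \<omega>. snr (\<xi> FU) (WU i \<omega>) (dist (follower i \<omega>) user)"
    and "SNR_LF \<equiv> \<lambda>i \<omega>. snr (\<xi> LF) WF (dist (assoc \<omega>) (follower i \<omega>))"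
    and "R_LFs \<equiv> prob_space.expectation M (\<lambda>\<omega>.
           indicator {\<omega>. central_angle (assoc \<omega>) user \<le> \<theta>max} \<omega> *
           ((\<Sum>i=1..NF. min (shannon (B LF) (SNR_LF i \<omega>)) (shannon (B FU) (SNR_FU i \<omega>)))
            + shannon (B LU) (SNR_LU \<omega>)))"
    \<comment> \<open>the terms of the closed form\<close>
    and "R_LU \<equiv> LBINT \<theta>:{0..\<theta>max}. LBINT w:{0..}.
           B LU * fW w * f_LU NL \<theta> * log 2 (1 + \<xi> LU * w / (r_LU Rearth Rsat \<theta>)\<^sup>2)"
    and "R_LF \<equiv> \<lambda>\<psi>. B LF * log 2 (1 + \<xi> LF * (WF / (r_LF Rsat \<psi>)\<^sup>2))"
    and "R_FU \<equiv> \<lambda>w \<theta> \<psi> \<phi>. B FU * log 2 (1 + \<xi> FU * (w / (r_FU Rearth Rsat \<theta> \<psi> \<phi>)\<^sup>2))"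
    and "E \<equiv> \<lambda>w. LBINT \<phi>:{0..2*pi}. LBINT \<psi>:{0..\<theta>cap}. LBINT \<theta>:{0..\<theta>max}.
           sin \<psi> * f_LU NL \<theta> / (2 * pi * (1 - cos \<theta>cap)) * min (R_LF \<psi>) (R_FU w \<theta> \<psi> \<phi>)"
  shows "R_LFs = real NF * (LBINT w:{0..}. E w * fW w) + R_LU"
proof -
  interpret prob_space M by fact
  have WF: "0 \<le> WF" using assms(26) by simp
  have Rsat: "0 < Rsat" "Rearth < Rsat"
    using assms(2,3) unfolding Rsat_def by simp_all
  have user: "user \<noteq> 0" "norm user = Rearth" "norm user < Rsat"
    using assms(2,5) Rsat by auto
  have "0 \<le> Rearth / Rsat" "Rearth / Rsat \<le> 1"
    using assms(2) Rsat by simp_all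
  then have "arccos (Rearth / Rsat) \<le> pi"
    by (intro arccos_ubound) auto
  \<comment> \<open>Both angles are positive and their sum is at most
    \<open>arccos (Rearth / Rsat)\<close>.\<close>
  then have angles: "\<theta>cap \<le> pi" "\<theta>max \<le> pi"
    using assms(8-10) by linarith+
  have WU: "WU i \<in> borel_measurable M" if "i \<in> {0..NF}" for i
    using distributed_measurable[OF assms(33)[OF that]] by simp
  interpret satellite_downlink M Rsat \<theta>cap NL NF user leader follower assoc leaders WU fW positions
  proof unfold_locales
    \<comment> \<open>The finite mean required by the locale is where the explicit shadowed-Rician
      distribution function enters.\<close>
    show "(\<integral>\<^sup>+\<omega>. ennreal (WU i \<omega>) \<partial>M) < \<infinity>" if "i \<in> {0..NF}" for i
      using assms(28-31) assms(34)[OF that] that WU[OF that]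
      by (intro nn_integral_shadowed_rician_finite[where \<Omega> = \<Omega> and ?b0.0 = b0 and m = m]) auto
  qed (fact user assms(6,8,11,31-33) angles assms(12) assms(16)[unfolded leader_space_def]
      assms(36)[unfolded leader_space_def follower_space_def] |
      simp only: leaders_def assoc_def positions_def)+
  have \<xi>: "0 < \<xi> q" for q
    using assms(19-24) by (simp add: \<xi>_def link_const_def zero_less_power2 order_less_imp_not_eq2[OF assms(21)] order_less_imp_not_eq2[OF assms(24)])
  show ?thesis
    unfolding R_LFs_def SNR_LU_def SNR_FU_def SNR_LF_def
    unfolding average_rate[OF assms(22)[of LF] assms(22)[of FU] assms(22)[of LU] \<xi>[of LF] \<xi>[of FU] \<xi>[of LU] WF angles(2)]
    unfolding E_def R_LU_def R_LF_def R_FU_def assms(5) shannon_def snr_def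
    by (simp add: mult_ac)
qed

end
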